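(* Let $\mathbf{x}=(x_1,x_2,\dots,x_m)$ be such that $1=x_1>x_2>\dots>x_m\ge0$, let $q\in(0,1]$, and let $\boldsymbol{\alpha}=(\alpha_1,\dots,\alpha_m)\in(0,1)^m$ be such that $\sum_{i=1}^m\alpha_i=1$. Let $X\sim\sum_{i=1}^m\alpha_i\Pi_{1-qx_i}$ and $n\ge3$. (a) If $m\ge2$, then $X([n])\in\mathcal{R}$ if $x_2$ is sufficiently close to $0$ (depending on $\alpha_1$). (b) If $m\ge2$, then $X([n])\in\mathcal{R}$ if $\alpha_1$ is sufficiently close to $1$. (c) If $m=2$, then $X([n])\notin\mathcal{R}$ if $x_2>0$ and $\alpha_1$ is sufficiently close to $0$ (depending on $x_2$ and $n$). (This is not true in general for $m\ge3$.)
   Context: For a finite set $S$ and a $\sigma$-finite measure $\nu$ on $\mathcal{P}(S)\setminus\{\emptyset\}$ (where $\mathcal{P}(S)$ is the power set), let $Y^\nu=\{B_j\}_{j\in I}$ be the Poisson process on $\mathcal{P}(S)\setminus\{\emptyset\}$ with intensity measure $\nu$. Define $X^\nu=(X^\nu_i)_{i\in S}$ by $X^\nu_i=1$ if $i\in\bigcup_{j\in I}B_j$ and $X^\nu_i=0$ otherwise. $\mathcal{R}$ denotes the set of all $\{0,1\}$-valued processes $(X_i)_{i\in S}$ that are equal in distribution to $X^\nu$ for some $\nu$. Here $S=[n]=\{1,\dots,n\}$, and $X([n])=(X_1,\dots,X_n)$ is the restriction of $X=(X_j)_{j\in\mathbb{N}}$ to $[n]$. $\Pi_p$ denotes the product measure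 on $\{0,1\}^{\mathbb{N}}$ in which each coordinate equals $1$ with probability $p$. For any $n$, whether $X([n])$ belongs to $\mathcal{R}$ does not depend on $q\in(0,1]$. *)

theory Defs
  imports "HOL-Probability.Probability" "HOL-Library.Multiset"
begin

text \<open>
  A \<open>{0,1}\<close>-valued process indexed by \<open>S\<close> is a random element of \<open>S \<rightarrow>\<^sub>E bool\<close>, with \<open>True\<close> for \<open>1\<close>
  and \<open>False\<close> for \<open>0\<close>.
\<close>

abbreviation binary_space :: "'i set \<Rightarrow> ('i \<Rightarrow> bool) measure" where
  "binary_space S \<equiv> PiM S (\<lambda>_. count_space UNIV)"

abbreviation num_points :: "('w \<Rightarrow> 'b multiset) \<Rightarrow> 'b set \<Rightarrow> 'w \<Rightarrow> nat" where
  "num_points Y A \<omega> \<equiv> size {#b \<in># Y \<omega>. b \<in> A#}"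

text \<open>
  The points of a realisation are kept with multiplicity. Finite multisets suffice because the
  intensity measure is finite: a sigma-finite measure on the finite set of nonempty subsets of \<open>S\<close>,
  with all sets measurable, is finite. In the last clause but one, \<open>0 ^ 0 = 1\<close> makes the
  number of points almost surely \<open>0\<close> in a set of intensity \<open>0\<close>.
\<close>

definition poisson_process :: "'w measure \<Rightarrow> ('w \<Rightarrow> 'b multiset) \<Rightarrow> 'b measure \<Rightarrow> bool" where
  "poisson_process M Y \<nu> \<longleftrightarrow>
     prob_space M \<and> finite_measure \<nu> \<and>
     (\<forall>\<omega>\<in>space M. set_mset (Y \<omega>) \<subseteq> space \<nu>) \<and>
     (\<forall>A\<in>sets \<nu>. num_points Y A \<in> measurable M (count_space UNIV)) \<and>
     (\<forall>A\<in>sets \<nu>. \<forall>k. measure M {\<omega>\<in>space M. num_points Y A \<omega> = k}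
                      = measure \<nu> A ^ k / fact k * exp (- measure \<nu> A)) \<and>
     (\<forall>A r. A ` {..<r::nat} \<subseteq> sets \<nu> \<longrightarrow> disjoint_family_on A {..<r} \<longrightarrow>
        prob_space.indep_vars M (\<lambda>_. count_space UNIV) (\<lambda>j. num_points Y (A j)) {..<r})"

definition covered :: "'i set \<Rightarrow> 'i set multiset \<Rightarrow> 'i \<Rightarrow> bool" where
  "covered S y = (\<lambda>i\<in>S. i \<in> \<Union> (set_mset y))"

text \<open>
  The class \<open>\<R>\<close>. Only the law of \<open>X\<^sup>\<nu>\<close> matters, so the Poisson process is taken, without loss of
  generality, to be the identity on a probability space of point configurations.
\<close>

definition poisson_representable :: "'i set \<Rightarrow> 'w measure \<Rightarrow> ('w \<Rightarrow> 'i \<Rightarrow> bool) \<Rightarrow> bool" where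
  "poisson_representable S M X \<longleftrightarrow>
     prob_space M \<and> X \<in> measurable M (binary_space S) \<and>
     (\<exists>(\<nu> :: 'i set measure) (P :: 'i set multiset measure).
        sets \<nu> = Pow (Pow S - {{}}) \<and> sigma_finite_measure \<nu> \<and>
        poisson_process P (\<lambda>y. y) \<nu> \<and>
        distr M (binary_space S) X = distr P (binary_space S) (covered S))"

text \<open>The product measure \<open>\<Pi>\<^sub>p\<close>; the index set of the sequences is \<open>{1, 2, \<dots>}\<close>.\<close>

definition bernoulli_product :: "real \<Rightarrow> (nat \<Rightarrow> bool) measure" where
  "bernoulli_product p = PiM {1..} (\<lambda>_. measure_pmf (bernoulli_pmf p))"

definition bernoulli_mixture ::
    "nat \<Rightarrow> (nat \<Rightarrow> real) \<Rightarrow> real \<Rightarrow> (nat \<Rightarrow> real) \<Rightarrow> (nat \<Rightarrow> bool) measure" where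
  "bernoulli_mixture m x q \<alpha> =
     measure_of (space (binary_space {1..})) (sets (binary_space {1..}))
       (\<lambda>A. \<Sum>i=1..m. ennreal (\<alpha> i) * emeasure (bernoulli_product (1 - q * x i)) A)"

definition has_law :: "'w measure \<Rightarrow> ('w \<Rightarrow> nat \<Rightarrow> bool) \<Rightarrow> (nat \<Rightarrow> bool) measure \<Rightarrow> bool" where
  "has_law M X \<mu> \<longleftrightarrow>
     prob_space M \<and> X \<in> measurable M (binary_space {1..}) \<and> distr M (binary_space {1..}) X = \<mu>"

definition restr :: "('w \<Rightarrow> nat \<Rightarrow> bool) \<Rightarrow> nat \<Rightarrow> 'w \<Rightarrow> nat \<Rightarrow> bool" where
  "restr X n \<omega> = restrict (X \<omega>) {1..n}"

definition admissible_points :: "nat \<Rightarrow> (nat \<Rightarrow> real) \<Rightarrow> bool" where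
  "admissible_points m x \<longleftrightarrow>
     1 \<le> m \<and> x 1 = 1 \<and> (\<forall>i\<in>{1..m}. \<forall>j\<in>{1..m}. i < j \<longrightarrow> x j < x i) \<and> 0 \<le> x m"

definition admissible_weights :: "nat \<Rightarrow> (nat \<Rightarrow> real) \<Rightarrow> bool" where
  "admissible_weights m \<alpha> \<longleftrightarrow> (\<forall>i\<in>{1..m}. 0 < \<alpha> i \<and> \<alpha> i < 1) \<and> (\<Sum>i=1..m. \<alpha> i) = 1"

text \<open>\<open>X \<sim> \<Sum>\<^sub>i \<alpha>\<^sub>i \<Pi>\<^sub>p\<close> with \<open>p = 1 - q x\<^sub>i\<close>, together with the standing assumptions on the parameters.\<close>

definition mixture_process :: "nat \<Rightarrow> (nat \<Rightarrow> real) \<Rightarrow> real \<Rightarrow> (nat \<Rightarrow> real) \<Rightarrow>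
    'w measure \<Rightarrow> ('w \<Rightarrow> nat \<Rightarrow> bool) \<Rightarrow> bool" where
  "mixture_process m x q \<alpha> M X \<longleftrightarrow>
     admissible_points m x \<and> 0 < q \<and> q \<le> 1 \<and> admissible_weights m \<alpha> \<and>
     has_law M X (bernoulli_mixture m x q \<alpha>)"

end

theory Submission
  imports Defs
begin

text \<open>
  If the probability \<open>v k\<close> of seeing only zeros on \<open>k\<close> given sites depends on \<open>k\<close> alone, then
  inclusion-exclusion determines the intensity of a set of size \<open>a\<close> as the alternating difference
  \<open>\<Sum>j\<le>a. (-1)^j * (a choose j) * ln (v (n - a + j))\<close>, so that representability on \<open>n\<close> sites means that
  these numbers are nonnegative. Here \<open>v k = q^k * L k\<close> with \<open>L k = (\<Sum>i. \<alpha>\<^sub>i * x\<^sub>i^k)\<close>; the factor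
  \<open>q^k\<close> only matters for \<open>a = 1\<close>, where nonnegativity is automatic. Write \<open>L k = \<alpha>\<^sub>1 * (1 + r k)\<close>.

  (a) If \<open>x\<^sub>2\<close> is small, \<open>r\<close> decays so fast that the first term of the difference dominates.
  (b) If \<open>\<alpha>\<^sub>1\<close> is close to \<open>1\<close>, \<open>r\<close> is small and the difference of \<open>ln (1 + r)\<close> is dominated by that
  of \<open>r\<close>, which is a sum of terms \<open>x\<^sub>i^k * (1 - x\<^sub>i)^a\<close>. (c) For \<open>m = 2\<close> and \<open>a = 3\<close>, the difference vanishes
  at \<open>\<alpha>\<^sub>1 = 0\<close> and has derivative \<open>x\<^sub>2^(3-n) * (1 - 1/x\<^sub>2)^3 < 0\<close> there. For \<open>m \<ge> 3\<close> and \<open>x\<^sub>i = c^(i-1)\<close> with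
  \<open>c\<close> small, the mixture without its first component is strictly inside the representable region
  by (a), and stays there when a small \<open>\<alpha>\<^sub>1\<close> is added.
\<close>

section \<open>Alternating differences\<close>

text \<open>The operator \<open>(1 - E) ^ a\<close> with \<open>E\<close> the shift of sequences,
  i.e. \<open>(-1) ^ a\<close> times the forward difference of order \<open>a\<close>. Nonnegativity
  of all its values is complete monotonicity.\<close>

primrec alt_diff :: "nat \<Rightarrow> (nat \<Rightarrow> real) \<Rightarrow> nat \<Rightarrow> real" where
  "alt_diff 0 \<phi> k = \<phi> k"
| "alt_diff (Suc a) \<phi> k = alt_diff a \<phi> k - alt_diff a \<phi> (Suc k)"

lemma alt_diff_add: "alt_diff a (\<lambda>j. \<phi> j + \<psi> j) k = alt_diff a \<phi> k + alt_diff a \<psi> k"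
  by (induction a arbitrary: k) auto

lemma alt_diff_cmult: "alt_diff a (\<lambda>j. c * \<phi> j) k = c * alt_diff a \<phi> k"
  by (induction a arbitrary: k) (auto simp: algebra_simps)

lemma alt_diff_sum:
  "alt_diff a (\<lambda>j. \<Sum>i\<in>I. \<phi> i j) k = (\<Sum>i\<in>I. alt_diff a (\<phi> i) k)"
  by (induction a arbitrary: k) (auto simp: sum_subtractf)

lemma alt_diff_power: "alt_diff a (\<lambda>j. z ^ j) k = z ^ k * (1 - z) ^ a"
  by (induction a arbitrary: k) (auto simp: algebra_simps)

lemma alt_diff_const: "1 \<le> a \<Longrightarrow> alt_diff a (\<lambda>_. c) k = 0"
  using alt_diff_cmult[of a c "\<lambda>_. 1" k] alt_diff_power[of a 1 k] by simp

text \<open>The defining recursion takes the extra difference last; taking it first suits sequences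
  whose first difference is simple.\<close>

lemma alt_diff_Suc: "alt_diff (Suc a) \<phi> k = alt_diff a (\<lambda>j. \<phi> j - \<phi> (Suc j)) k"
proof (induction a arbitrary: k)
  case (Suc a)
  then show ?case by (simp only: alt_diff.simps(2)[of "Suc a"] alt_diff.simps(2)[of a "\<lambda>j. \<phi> j - \<phi> (Suc j)"])
qed simp

text \<open>One difference makes the sequence constant and a second one kills it. A factor
  \<open>z ^ k\<close> with \<open>z > 0\<close> inside a logarithm contributes
  \<open>k * ln z\<close>, so it is invisible from order 2 on.\<close>

lemma alt_diff_linear:
  assumes "2 \<le> a"
  shows "alt_diff a (\<lambda>j. real j * c) k = 0"
proof -
  obtain b where b: "a = Suc b" "1 \<le> b"
    using assms by (cases a) auto
  have "(\<lambda>j. real j * c - real (Suc j) * c) = (\<lambda>_. - c)"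
    by (auto simp: algebra_simps)
  then show ?thesis
    using b by (simp only: alt_diff_Suc alt_diff_const)
qed

lemma alt_diff_sums:
  assumes "\<And>j. (\<lambda>l. s l j) sums \<phi> j"
  shows "(\<lambda>l. alt_diff a (s l) k) sums alt_diff a \<phi> k"
  using assms by (induction a arbitrary: k) (auto intro: sums_diff)

lemma alt_diff_tendsto:
  assumes "\<And>j. ((\<lambda>t. f t j) \<longlongrightarrow> \<phi> j) F"
  shows "((\<lambda>t. alt_diff a (f t) k) \<longlongrightarrow> alt_diff a \<phi> k) F"
  using assms by (induction a arbitrary: k) (auto intro: tendsto_diff)

lemma alt_diff_has_real_derivative:
  assumes "\<And>j. ((\<lambda>t. f t j) has_real_derivative \<phi> j) (at x within A)"
  shows "((\<lambda>t. alt_diff a (f t) k) has_real_derivative alt_diff a \<phi> k) (at x within A)"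
  using assms by (induction a arbitrary: k) (auto intro: DERIV_diff)

lemma abs_alt_diff_le:
  assumes "\<And>j. k \<le> j \<Longrightarrow> \<bar>\<phi> j\<bar> \<le> B"
  shows "\<bar>alt_diff a \<phi> k\<bar> \<le> 2 ^ a * B"
  using assms
proof (induction a arbitrary: k)
  case (Suc a)
  then have "\<bar>alt_diff a \<phi> k\<bar> \<le> 2 ^ a * B" "\<bar>alt_diff a \<phi> (Suc k)\<bar> \<le> 2 ^ a * B"
    using Suc_leD by blast+
  then show ?case by simp
qed simp

text \<open>Of the \<open>2 ^ a\<close> signed terms of the difference only one sits at
  \<open>k\<close>; the other \<open>2 ^ a - 1\<close> have later indices.\<close>

lemma alt_diff_ge:
  assumes "\<And>j. k < j \<Longrightarrow> \<bar>\<phi> j\<bar> \<le> B"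
  shows "\<phi> k - (2 ^ a - 1) * B \<le> alt_diff a \<phi> k"
proof (induction a)
  case (Suc a)
  have "\<bar>alt_diff a \<phi> (Suc k)\<bar> \<le> 2 ^ a * B"
    using assms by (intro abs_alt_diff_le) auto
  with Suc show ?case by (simp add: algebra_simps)
qed simp

text \<open>Adjoining \<open>x\<close> pairs each subset \<open>U\<close> with
  \<open>insert x U\<close>, which has the opposite sign and an index larger by one: this is the
  recursion of \<open>alt_diff\<close>.\<close>

lemma sum_Pow_alternating:
  assumes "finite A"
  shows "(\<Sum>U\<in>Pow A. (- 1) ^ card U * \<phi> (k + card U)) = alt_diff (card A) \<phi> k"
  using assms
proof (induction A arbitrary: k rule: finite_induct)
  case (insert x A)
  have inj: "inj_on (insert x) (Pow A)"
    using insert.hyps by (intro inj_onI) (metis PowD insert_ident subsetD)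
  have disj: "Pow A \<inter> insert x ` Pow A = {}"
    using insert.hyps by auto
  have "(\<Sum>U\<in>Pow (insert x A). (- 1) ^ card U * \<phi> (k + card U))
      = (\<Sum>U\<in>Pow A. (- 1) ^ card U * \<phi> (k + card U))
        + (\<Sum>U\<in>Pow A. (- 1) ^ card (insert x U) * \<phi> (k + card (insert x U)))"
    unfolding Pow_insert using insert.hyps disj inj
    by (subst sum.union_disjoint) (auto simp: sum.reindex)
  also have "(\<Sum>U\<in>Pow A. (- 1) ^ card (insert x U) * \<phi> (k + card (insert x U)))
      = (\<Sum>U\<in>Pow A. - ((- 1) ^ card U * \<phi> (Suc k + card U)))"
  proof (intro sum.cong refl)
    fix U assume "U \<in> Pow A"
    then have "finite U" "x \<notin> U"
      using insert.hyps by (auto intro: finite_subset)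
    then show "(- 1) ^ card (insert x U) * \<phi> (k + card (insert x U))
        = - ((- 1) ^ card U * \<phi> (Suc k + card U))"
      by simp
  qed
  finally show ?case
    using insert.IH[of k] insert.IH[of "Suc k"] insert.hyps by (simp add: sum_negf)
qed simp

section \<open>Logarithms of moment sequences\<close>

text \<open>Moments of a finite measure on \<open>[0,1]\<close> with mass \<open>\<beta> i\<close>
  at \<open>x i\<close>. The total mass is left free, since it will measure the weight of the
  remaining components relative to the first.\<close>

locale moment_sequence =
  fixes I :: "'i set" and \<beta> x :: "'i \<Rightarrow> real"
  assumes finite_I: "finite I"
    and weight_nonneg: "i \<in> I \<Longrightarrow> 0 \<le> \<beta> i"
    and point_nonneg: "i \<in> I \<Longrightarrow> 0 \<le> x i"
    and point_le_1: "i \<in> I \<Longrightarrow> x i \<le> 1"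
begin

definition moment :: "nat \<Rightarrow> real" where
  "moment k = (\<Sum>i\<in>I. \<beta> i * x i ^ k)"

lemma moment_nonneg: "0 \<le> moment k"
  unfolding moment_def by (intro sum_nonneg mult_nonneg_nonneg zero_le_power weight_nonneg point_nonneg)

lemma moment_antimono: "j \<le> k \<Longrightarrow> moment k \<le> moment j"
  unfolding moment_def
  by (intro sum_mono mult_left_mono power_decreasing weight_nonneg point_nonneg point_le_1)

text \<open>The leading term satisfies
  \<open>ln (1 + moment k) \<ge> moment k / (1 + moment 0)\<close>, while every later one is at most
  \<open>moment (Suc k) \<le> d * moment k\<close>; \<open>alt_diff_ge\<close> weighs these against
  each other.\<close>

lemma alt_diff_ln_moment_ge:
  assumes d: "\<And>i. i \<in> I \<Longrightarrow> x i \<le> d" and "0 \<le> d"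
  shows "moment k * (1 / (1 + moment 0) - 2 ^ a * d) \<le> alt_diff a (\<lambda>j. ln (1 + moment j)) k"
proof -
  have step: "moment (Suc k) \<le> d * moment k"
    unfolding moment_def sum_distrib_left
  proof (intro sum_mono)
    fix i assume i: "i \<in> I"
    have "\<beta> i * x i ^ k * x i \<le> \<beta> i * x i ^ k * d"
      using weight_nonneg[OF i] point_nonneg[OF i] d[OF i] by (intro mult_left_mono) auto
    then show "\<beta> i * x i ^ Suc k \<le> d * (\<beta> i * x i ^ k)"
      by (simp add: mult_ac)
  qed
  have "\<bar>ln (1 + moment j)\<bar> \<le> moment (Suc k)" if "k < j" for j
    using ln_add_one_self_le_self[OF moment_nonneg[of j]] moment_antimono[of "Suc k" j]
      moment_nonneg[of j] that by simp
  from alt_diff_ge[of k "\<lambda>j. ln (1 + moment j)", OF this, of a]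
  have "ln (1 + moment k) - (2 ^ a - 1) * moment (Suc k) \<le> alt_diff a (\<lambda>j. ln (1 + moment j)) k" .
  moreover have "(2 ^ a - 1) * moment (Suc k) \<le> 2 ^ a * (d * moment k)"
    using step moment_nonneg[of "Suc k"] by (intro mult_mono) auto
  moreover have "moment k / (1 + moment 0) \<le> ln (1 + moment k)"
  proof -
    have "moment k / (1 + moment 0) \<le> moment k / (1 + moment k)"
      using moment_nonneg[of k] moment_antimono[of 0 k] by (intro divide_left_mono) auto
    also have "\<dots> = 1 - inverse (1 + moment k)"
      using moment_nonneg[of k] by (simp add: field_simps)
    also have "\<dots> \<le> ln (1 + moment k)"
      using ln_le_minus_one[of "inverse (1 + moment k)"] moment_nonneg[of k] by (simp add: ln_inverse)
    finally show ?thesis .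
  qed
  ultimately show ?thesis by (simp add: algebra_simps)
qed

text \<open>Expanding one factor \<open>moment j\<close> replaces \<open>z\<close> by
  \<open>z * x i\<close> and lowers the exponent. The geometric factor \<open>z ^ j\<close> is
  carried along so that an induction on the exponent closes.\<close>

lemma alt_diff_moment_power_Suc:
  "alt_diff a (\<lambda>j. z ^ j * moment j ^ Suc l) k
    = (\<Sum>i\<in>I. \<beta> i * alt_diff a (\<lambda>j. (z * x i) ^ j * moment j ^ l) k)"
proof -
  have "z ^ j * moment j ^ Suc l = (\<Sum>i\<in>I. \<beta> i * ((z * x i) ^ j * moment j ^ l))" for j
  proof -
    have "z ^ j * moment j ^ Suc l = z ^ j * moment j ^ l * moment j"
      by simp
    also have "\<dots> = (\<Sum>i\<in>I. z ^ j * moment j ^ l * (\<beta> i * x i ^ j))"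
      by (subst (2) moment_def) (simp add: sum_distrib_left)
    finally show ?thesis by (simp add: power_mult_distrib mult_ac)
  qed
  then show ?thesis by (simp only: alt_diff_sum alt_diff_cmult)
qed

lemma alt_diff_moment: "alt_diff a moment k = (\<Sum>i\<in>I. \<beta> i * (x i ^ k * (1 - x i) ^ a))"
  using alt_diff_moment_power_Suc[of a 1 0 k] by (simp add: alt_diff_power)

end

section \<open>Differences of powers of a moment sequence\<close>

text \<open>If \<open>y\<close> is the smaller of the two, then \<open>z * y \<le> y\<close> and
  \<open>1 - z * y \<le> 1 - y * y \<le> 2 * (1 - y)\<close>, so \<open>y\<close> alone gives the
  bound. The sum on the right covers both orders.\<close>

lemma power_mult_one_minus_le:
  fixes z y :: real
  assumes "0 \<le> z" "z \<le> 1" "0 \<le> y" "y \<le> 1"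
  shows "(z * y) ^ k * (1 - z * y) ^ a \<le> 2 ^ a * (z ^ k * (1 - z) ^ a + y ^ k * (1 - y) ^ a)"
proof -
  have *: "(u * v) ^ k * (1 - u * v) ^ a \<le> 2 ^ a * (v ^ k * (1 - v) ^ a)"
    if "0 \<le> u" "u \<le> 1" "0 \<le> v" "v \<le> 1" "v \<le> u" for u v :: real
  proof -
    have "u * v \<le> v" "0 \<le> u * v" "v * v \<le> u * v"
      using that by (auto simp: mult_left_le_one_le intro: mult_right_mono)
    moreover have "1 - v * v \<le> 2 * (1 - v)"
      using zero_le_power2[of "1 - v"] by (simp add: power2_eq_square algebra_simps)
    ultimately have "1 - u * v \<le> 2 * (1 - v)" "0 \<le> 1 - u * v"
      using that by linarith+
    then have "(u * v) ^ k * (1 - u * v) ^ a \<le> v ^ k * (2 * (1 - v)) ^ a"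
      using \<open>u * v \<le> v\<close> \<open>0 \<le> u * v\<close> that by (intro mult_mono power_mono) auto
    then show ?thesis by (simp only: power_mult_distrib mult_ac)
  qed
  have "0 \<le> 2 ^ a * (z ^ k * (1 - z) ^ a)" "0 \<le> 2 ^ a * (y ^ k * (1 - y) ^ a)"
    using assms by auto
  then show ?thesis
    using *[of z y] *[of y z] assms
    unfolding mult.commute[of y z] distrib_left by linarith
qed

context moment_sequence
begin

text \<open>Induction on \<open>l\<close>: each step moves to \<open>z * x i\<close> and splits its
  weight into those of \<open>z\<close> and \<open>x i\<close> at the cost of a factor
  \<open>2 ^ a\<close>. At \<open>z = 1\<close> and \<open>a \<ge> 1\<close> the first summand
  vanishes, leaving a multiple of \<open>T\<close>.\<close>

lemma alt_diff_moment_power_bounds: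
  fixes a k :: nat and z :: real
  defines "T \<equiv> alt_diff a moment k"
  assumes "0 \<le> z" "z \<le> 1"
  shows "0 \<le> alt_diff a (\<lambda>j. z ^ j * moment j ^ l) k"
    and "alt_diff a (\<lambda>j. z ^ j * moment j ^ l) k
      \<le> (2 ^ a * moment 0) ^ l * (z ^ k * (1 - z) ^ a) + real l * (2 ^ a) ^ l * moment 0 ^ (l - 1) * T"
  using assms(2,3)
proof (induction l arbitrary: z)
  case 0
  { case 1 then show ?case by (simp add: alt_diff_power) next
    case 2 then show ?case by (simp add: alt_diff_power) }
next
  case (Suc l)
  define P :: real where "P = 2 ^ a"
  define \<rho> where "\<rho> = moment 0"
  define w where "w y = y ^ k * (1 - y) ^ a" for y :: real
  define B where "B = real l * P ^ l * \<rho> ^ (l - 1) * T"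
  have rho: "\<rho> = (\<Sum>i\<in>I. \<beta> i)" and rho0: "0 \<le> \<rho>"
    using moment_nonneg[of 0] by (auto simp: \<rho>_def moment_def)
  have P: "1 \<le> P"
    by (simp add: P_def)
  have T: "T = (\<Sum>i\<in>I. \<beta> i * w (x i))"
    by (simp add: T_def alt_diff_moment w_def)
  have T0: "0 \<le> T"
    unfolding T w_def using weight_nonneg point_nonneg point_le_1
    by (intro sum_nonneg mult_nonneg_nonneg zero_le_power) auto
  { case 1
    then show ?case
      unfolding alt_diff_moment_power_Suc
      using weight_nonneg point_nonneg point_le_1
      by (intro sum_nonneg mult_nonneg_nonneg Suc.IH(1)) (auto intro: mult_le_one)
  next
    case 2
    have "alt_diff a (\<lambda>j. z ^ j * moment j ^ Suc l) k
        \<le> (\<Sum>i\<in>I. \<beta> i * ((P * \<rho>) ^ l * (P * (w z + w (x i))) + B))"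
      unfolding alt_diff_moment_power_Suc
    proof (intro sum_mono mult_left_mono)
      fix i assume i: "i \<in> I"
      have "alt_diff a (\<lambda>j. (z * x i) ^ j * moment j ^ l) k \<le> (P * \<rho>) ^ l * w (z * x i) + B"
        using Suc.IH(2)[of "z * x i"] point_nonneg[OF i] point_le_1[OF i] 2
        by (simp add: mult_le_one P_def \<rho>_def w_def B_def)
      also have "\<dots> \<le> (P * \<rho>) ^ l * (P * (w z + w (x i))) + B"
        using power_mult_one_minus_le[of z "x i" k a] 2 point_nonneg[OF i] point_le_1[OF i] P rho0
        by (intro add_right_mono mult_left_mono) (auto simp: w_def P_def)
      finally show "alt_diff a (\<lambda>j. (z * x i) ^ j * moment j ^ l) k
          \<le> (P * \<rho>) ^ l * (P * (w z + w (x i))) + B" .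
    qed (rule weight_nonneg)
    also have "\<dots> = (\<Sum>i\<in>I. (P * \<rho>) ^ l * P * w z * \<beta> i + (P * \<rho>) ^ l * P * (\<beta> i * w (x i)) + B * \<beta> i)"
      by (intro sum.cong refl) (simp add: algebra_simps)
    also have "\<dots> = (P * \<rho>) ^ l * P * w z * \<rho> + (P * \<rho>) ^ l * P * T + B * \<rho>"
      unfolding T rho by (simp only: sum.distrib sum_distrib_left)
    \<comment> \<open>At \<open>l = 0\<close> the exponent \<open>l - 1\<close> is truncated, but
      the factor \<open>real l\<close> makes both sides zero.\<close>
    also have "B * \<rho> = real l * P ^ l * \<rho> ^ l * T"
      by (cases l) (auto simp: B_def mult_ac)
    also have "\<dots> \<le> real l * (P * P ^ l) * \<rho> ^ l * T"
      using P T0 rho0 mult_right_mono[of 1 P "P ^ l"] by (intro mult_right_mono mult_left_mono) auto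
    finally show ?case
      by (simp add: P_def[symmetric] \<rho>_def[symmetric] w_def[symmetric] algebra_simps)
  }
qed

text \<open>
  For a small total mass the linear term of the logarithmic series dominates. The bound is uniform
  in the points, because every higher order term is controlled by the linear one.
\<close>

lemma alt_diff_ln_moment_nonneg:
  assumes a: "1 \<le> a" and small: "2 * 4 ^ a * moment 0 \<le> 1"
  shows "0 \<le> alt_diff a (\<lambda>j. ln (1 + moment j)) k"
proof -
  define T where "T = alt_diff a moment k"
  define P :: real where "P = 2 ^ a"
  define y where "y = P * moment 0"
  define s where "s l = - ((- 1) ^ l) / real l * alt_diff a (\<lambda>j. moment j ^ l) k" for l
  have bounds: "0 \<le> alt_diff a (\<lambda>j. moment j ^ l) k"
      "alt_diff a (\<lambda>j. moment j ^ l) k \<le> real l * P ^ l * moment 0 ^ (l - 1) * T" for l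
    using alt_diff_moment_power_bounds[of 1 a l k] a by (auto simp: T_def P_def power_0_left)
  have P: "1 \<le> P" and PP: "4 ^ a = P * P"
    by (auto simp: P_def simp flip: power_mult_distrib)
  \<comment> \<open>The factor \<open>4 ^ a\<close> in the hypothesis supplies two powers of
    \<open>P\<close>: one enters the ratio \<open>y\<close> of the geometric tail below, the other
    its prefactor \<open>P * y\<close>.\<close>
  have "2 * P * y \<le> 1"
    using small PP by (simp add: y_def mult_ac)
  moreover have y0: "0 \<le> y"
    using P moment_nonneg[of 0] by (simp add: y_def)
  ultimately have y: "P * (2 * y) \<le> 1" "2 * y \<le> 1"
    using P mult_right_mono[of 1 P "2 * y"] by auto
  have T0: "0 \<le> T"
    using bounds(1)[of 1] by (simp add: T_def)
  have "moment j < 1" for j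
  proof -
    have "moment j \<le> moment 0" by (simp add: moment_antimono)
    also have "\<dots> \<le> y" using P moment_nonneg[of 0] mult_right_mono[of 1 P "moment 0"] by (simp add: y_def)
    finally show ?thesis using y y0 by linarith
  qed
  then have "(\<lambda>l. - ((- moment j) ^ l) / real l) sums ln (1 + moment j)" for j
    using moment_nonneg[of j] by (intro ln_series') auto
  then have "(\<lambda>l. alt_diff a (\<lambda>j. - ((- moment j) ^ l) / real l) k)
      sums alt_diff a (\<lambda>j. ln (1 + moment j)) k"
    by (rule alt_diff_sums)
  moreover have "alt_diff a (\<lambda>j. - ((- moment j) ^ l) / real l) k = s l" for l
  proof -
    have "(\<lambda>j. - ((- moment j) ^ l) / real l) = (\<lambda>j. - ((- 1) ^ l) / real l * moment j ^ l)"
      by (rule ext) (subst power_minus, simp)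
    then show ?thesis by (simp only: alt_diff_cmult s_def)
  qed
  ultimately have "s sums alt_diff a (\<lambda>j. ln (1 + moment j)) k" by simp
  then have tail: "(\<lambda>l. s (l + 2)) sums (alt_diff a (\<lambda>j. ln (1 + moment j)) k - (\<Sum>l<2. s l))"
    by (rule sums_split_initial_segment)
  \<comment> \<open>The term at \<open>l = 0\<close> is a division by zero and hence 0, so the two
    initial terms contribute just the linear term \<open>T\<close>.\<close>
  have first: "(\<Sum>l<2. s l) = T"
    by (simp add: s_def T_def numeral_2_eq_2)
  have geometric: "(\<lambda>l. - (P * T * y) * y ^ l) sums (- (P * T * y) * (1 / (1 - y)))"
    using y y0 by (intro sums_mult geometric_sums) auto
  \<comment> \<open>The factor \<open>l + 2\<close> in the bound on the power cancels against the
    coefficient \<open>1 / (l + 2)\<close> of the logarithmic series, leaving a geometric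
    majorant.\<close>
  have "- (P * T * y) * y ^ l \<le> s (l + 2)" for l
  proof -
    have "\<bar>s (l + 2)\<bar> = alt_diff a (\<lambda>j. moment j ^ (l + 2)) k / real (l + 2)"
      using bounds(1)[of "l + 2"] by (simp add: s_def abs_mult)
    also have "\<dots> \<le> real (l + 2) * P ^ (l + 2) * moment 0 ^ (l + 2 - 1) * T / real (l + 2)"
      by (intro divide_right_mono bounds(2)) simp
    also have "\<dots> = P * T * y * y ^ l"
      by (simp add: y_def power_mult_distrib mult_ac)
    finally show ?thesis
      unfolding mult_minus_left by linarith
  qed
  then have "- (P * T * y) * (1 / (1 - y)) \<le> alt_diff a (\<lambda>j. ln (1 + moment j)) k - T"
    using sums_le[OF _ geometric tail] by (simp only: first)
  \<comment> \<open>Both \<open>P * y\<close> and \<open>y\<close> are at most \<open>1/2\<close>,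
    so the whole tail is at most \<open>T\<close>.\<close>
  moreover have "P * T * y * (1 / (1 - y)) \<le> T"
  proof -
    have "P * y \<le> 1 - y"
      using y by linarith
    then have "T * (P * y) \<le> T * (1 - y)"
      using T0 by (rule mult_left_mono)
    then have "T * (P * y) / (1 - y) \<le> T"
      using pos_divide_le_eq[of "1 - y" "T * (P * y)" T] y y0 by linarith
    moreover have "P * T * y * (1 / (1 - y)) = T * (P * y) / (1 - y)"
      by simp
    ultimately show ?thesis by linarith
  qed
  ultimately show ?thesis
    unfolding mult_minus_left by linarith
qed

end

section \<open>Void probabilities and Poisson processes\<close>

definition all_zero :: "'i set \<Rightarrow> 'i set \<Rightarrow> ('i \<Rightarrow> bool) set" where
  "all_zero S K = {f \<in> space (binary_space S). \<forall>i\<in>K. \<not> f i}"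

lemma all_zero_measurable:
  assumes "finite K" "K \<subseteq> S"
  shows "all_zero S K \<in> sets (binary_space S)"
proof -
  have "{f \<in> space (binary_space S). \<not> f i} \<in> sets (binary_space S)" if "i \<in> K" for i
  proof -
    have "(\<lambda>f. f i) \<in> measurable (binary_space S) (count_space UNIV)"
      using that assms(2) by (intro measurable_component_singleton) auto
    then have "(\<lambda>f. f i) -` {False} \<inter> space (binary_space S) \<in> sets (binary_space S)"
      by (rule measurable_sets) simp
    moreover have "(\<lambda>f. f i) -` {False} \<inter> space (binary_space S) = {f \<in> space (binary_space S). \<not> f i}"
      by auto
    ultimately show ?thesis by simp
  qed
  then show ?thesis
    unfolding all_zero_def using assms(1) by (intro sets.sets_Collect_finite_All)
qed

lemma sets_binary_space_eq:
  assumes "finite S"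
  shows "sets (binary_space S) = sigma_sets (space (binary_space S)) (all_zero S ` Pow S)"
proof
  let ?\<Omega> = "space (binary_space S)"
  interpret sigma_algebra ?\<Omega> "sigma_sets ?\<Omega> (all_zero S ` Pow S)"
    by (rule sigma_algebra_sigma_sets) (auto simp: all_zero_def)
  have "{f \<in> ?\<Omega>. f i \<in> A} \<in> sigma_sets ?\<Omega> (all_zero S ` Pow S)" if i: "i \<in> S" for i A
  proof -
    have Z: "{f \<in> ?\<Omega>. \<not> f i} \<in> sigma_sets ?\<Omega> (all_zero S ` Pow S)"
      using i by (intro sigma_sets.Basic image_eqI[of _ _ "{i}"]) (auto simp: all_zero_def)
    have "{f \<in> ?\<Omega>. f i \<in> A} =
        (if False \<in> A then {f \<in> ?\<Omega>. \<not> f i} else {}) \<union> (if True \<in> A then ?\<Omega> - {f \<in> ?\<Omega>. \<not> f i} else {})"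
      by (auto split: if_splits) (metis (full_types))+
    then show ?thesis
      using Z by auto
  qed
  then show "sets (binary_space S) \<subseteq> sigma_sets ?\<Omega> (all_zero S ` Pow S)"
    unfolding sets_PiM_single space_PiM[symmetric] by (intro sigma_sets_mono) auto
  show "sigma_sets ?\<Omega> (all_zero S ` Pow S) \<subseteq> sets (binary_space S)"
    using assms by (intro sets.sigma_sets_subset) (auto intro!: all_zero_measurable intro: finite_subset)
qed

text \<open>Void events on \<open>K\<close> and \<open>L\<close> intersect in the void event on
  \<open>K \<union> L\<close>, so they form an intersection-stable generator and their probabilities
  determine the law.\<close>

lemma binary_space_measure_eqI:
  assumes "finite S" "prob_space M" "prob_space N"
    and M: "sets M = sets (binary_space S)" and N: "sets N = sets (binary_space S)"
    and eq: "\<And>K. K \<subseteq> S \<Longrightarrow> measure M (all_zero S K) = measure N (all_zero S K)"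
  shows "M = N"
proof (rule measure_eqI_generator_eq[where E = "all_zero S ` Pow S"
      and \<Omega> = "space (binary_space S)" and A = "\<lambda>_. all_zero S {}"])
  interpret M: prob_space M by fact
  interpret N: prob_space N by fact
  show "Int_stable (all_zero S ` Pow S)"
  proof (rule Int_stableI)
    fix A B assume "A \<in> all_zero S ` Pow S" "B \<in> all_zero S ` Pow S"
    then obtain K L where "A = all_zero S K" "B = all_zero S L" "K \<subseteq> S" "L \<subseteq> S"
      by auto
    then show "A \<inter> B \<in> all_zero S ` Pow S"
      by (intro image_eqI[of _ _ "K \<union> L"]) (auto simp: all_zero_def)
  qed
  show "emeasure M X = emeasure N X" if "X \<in> all_zero S ` Pow S" for X
    using that eq by (auto simp: M.emeasure_eq_measure N.emeasure_eq_measure)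
  show "emeasure M (all_zero S {}) \<noteq> \<infinity>"
    by simp
qed (use sets_binary_space_eq[OF assms(1)] M N in \<open>auto simp: all_zero_def\<close>)

definition void_probability :: "'i set \<Rightarrow> 'w measure \<Rightarrow> ('w \<Rightarrow> 'i \<Rightarrow> bool) \<Rightarrow> 'i set \<Rightarrow> real" where
  "void_probability S M X K = measure (distr M (binary_space S) X) (all_zero S K)"

text \<open>The sites of \<open>K\<close> stay uncovered iff no point of the configuration meets
  \<open>K\<close>, and the number of points meeting \<open>K\<close> is Poisson.\<close>

lemma poisson_void_probability:
  assumes S: "finite S" and \<nu>: "sets \<nu> = Pow (Pow S - {{}})"
    and P: "poisson_process P (\<lambda>y. y) \<nu>"
  shows "covered S \<in> measurable P (binary_space S)"
    and "K \<subseteq> S \<Longrightarrow> void_probability S P (covered S) K = exp (- measure \<nu> {B \<in> Pow S. B \<inter> K \<noteq> {}})"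
proof -
  have space: "space \<nu> = Pow S - {{}}"
    using \<nu> by (metis Pow_iff Pow_top sets.sets_into_space sets.top subset_antisym)
  have sub: "set_mset y \<subseteq> Pow S - {{}}" if "y \<in> space P" for y
    using P that by (auto simp: poisson_process_def space)
  have num: "num_points (\<lambda>y. y) A \<in> measurable P (count_space UNIV)" if "A \<subseteq> Pow S - {{}}" for A
    using P that by (auto simp: poisson_process_def \<nu>)
  have num0: "num_points (\<lambda>y. y) {B \<in> Pow S. B \<inter> K \<noteq> {}} y = 0 \<longleftrightarrow> (\<forall>i\<in>K. \<not> covered S y i)"
    if "y \<in> space P" "K \<subseteq> S" for y K
  proof -
    have "num_points (\<lambda>y. y) {B \<in> Pow S. B \<inter> K \<noteq> {}} y = 0
        \<longleftrightarrow> (\<forall>B\<in>set_mset y. \<not> (B \<in> Pow S \<and> B \<inter> K \<noteq> {}))"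
      by (simp only: size_eq_0_iff_empty filter_mset_eq_mempty_iff) blast
    also have "\<dots> \<longleftrightarrow> (\<forall>i\<in>K. \<not> covered S y i)"
    proof -
      have "covered S y i \<longleftrightarrow> (\<exists>B\<in>set_mset y. i \<in> B)" if "i \<in> K" for i
        using that \<open>K \<subseteq> S\<close> by (auto simp: covered_def)
      moreover have "(\<forall>B\<in>set_mset y. \<not> (B \<in> Pow S \<and> B \<inter> K \<noteq> {})) \<longleftrightarrow> (\<forall>B\<in>set_mset y. B \<inter> K = {})"
        using sub[OF that(1)] by (intro ball_cong refl) auto
      moreover have "\<dots> \<longleftrightarrow> (\<forall>i\<in>K. \<not> (\<exists>B\<in>set_mset y. i \<in> B))"
        by blast
      ultimately show ?thesis
        by simp
    qed
    finally show ?thesis .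
  qed
  \<comment> \<open>The sigma-algebra of \<open>P\<close> is arbitrary and only counts are known to
    be measurable, so coordinate \<open>i\<close> is expressed through the number of points
    containing \<open>i\<close>.\<close>
  have "(\<lambda>y. covered S y i) \<in> measurable P (count_space UNIV)" if i: "i \<in> S" for i
  proof -
    have "(\<lambda>n::nat. n \<noteq> 0) \<in> measurable (count_space UNIV) (count_space UNIV)"
      by simp
    from measurable_compose[OF num this, of "{B \<in> Pow S. B \<inter> {i} \<noteq> {}}"]
    have "(\<lambda>y. num_points (\<lambda>y. y) {B \<in> Pow S. B \<inter> {i} \<noteq> {}} y \<noteq> 0) \<in> measurable P (count_space UNIV)"
      by auto
    then show ?thesis
      by (rule measurable_cong[THEN iffD1, rotated]) (use num0[of _ "{i}"] i in auto)
  qed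
  then have "(\<lambda>y. \<lambda>i\<in>S. covered S y i) \<in> measurable P (binary_space S)"
    by (intro measurable_restrict) auto
  moreover have "(\<lambda>y. \<lambda>i\<in>S. covered S y i) = covered S"
    by (intro ext) (auto simp: covered_def)
  ultimately show meas: "covered S \<in> measurable P (binary_space S)"
    by simp
  show "void_probability S P (covered S) K = exp (- measure \<nu> {B \<in> Pow S. B \<inter> K \<noteq> {}})" if K: "K \<subseteq> S"
  proof -
    have "void_probability S P (covered S) K = measure P (covered S -` all_zero S K \<inter> space P)"
      unfolding void_probability_def using S K finite_subset
      by (intro measure_distr meas all_zero_measurable) auto
    also have "covered S -` all_zero S K \<inter> space P
        = {y \<in> space P. num_points (\<lambda>y. y) {B \<in> Pow S. B \<inter> K \<noteq> {}} y = 0}"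
      using measurable_space[OF meas] num0[OF _ K] by (auto simp: all_zero_def)
    also have "measure P \<dots> = exp (- measure \<nu> {B \<in> Pow S. B \<inter> K \<noteq> {}})"
    proof -
      have "{B \<in> Pow S. B \<inter> K \<noteq> {}} \<in> sets \<nu>"
        by (auto simp: \<nu>)
      then have "measure P {y \<in> space P. num_points (\<lambda>y. y) {B \<in> Pow S. B \<inter> K \<noteq> {}} y = 0}
          = measure \<nu> {B \<in> Pow S. B \<inter> K \<noteq> {}} ^ 0 / fact 0 * exp (- measure \<nu> {B \<in> Pow S. B \<inter> K \<noteq> {}})"
        using P unfolding poisson_process_def by blast
      then show ?thesis by simp
    qed
    finally show ?thesis .
  qed
qed

section \<open>Existence of Poisson processes with finite intensity on a finite set\<close>

text \<open>The library's \<open>poisson_pmf\<close> is specified only for positive rates.\<close>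

definition poisson0_pmf :: "real \<Rightarrow> nat pmf" where
  "poisson0_pmf u = (if 0 < u then poisson_pmf u else return_pmf 0)"

lemma pmf_poisson0: "0 \<le> u \<Longrightarrow> pmf (poisson0_pmf u) k = u ^ k / fact k * exp (- u)"
  by (cases "u = 0") (auto simp: poisson0_pmf_def power_0_left)

text \<open>The convolution at \<open>k\<close> is the binomial expansion of
  \<open>(u + v) ^ k\<close>.\<close>

lemma poisson0_pmf_add:
  assumes "0 \<le> u" "0 \<le> v"
  shows "bind_pmf (poisson0_pmf u) (\<lambda>a. map_pmf (\<lambda>b. a + b) (poisson0_pmf v)) = poisson0_pmf (u + v)"
proof (rule pmf_eqI)
  fix k
  have pmf_shift: "pmf (map_pmf (\<lambda>b. a + b) (poisson0_pmf v)) k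
      = (if a \<le> k then pmf (poisson0_pmf v) (k - a) else 0)" for a
  proof (cases "a \<le> k")
    case True
    then show ?thesis
      using pmf_map_inj'[of "\<lambda>b. a + b" "poisson0_pmf v" "k - a"] by (simp add: inj_def)
  next
    case False
    then show ?thesis by (auto simp: pmf_eq_0_set_pmf)
  qed
  have "pmf (bind_pmf (poisson0_pmf u) (\<lambda>a. map_pmf (\<lambda>b. a + b) (poisson0_pmf v))) k
      = (\<Sum>a\<le>k. pmf (poisson0_pmf u) a * pmf (poisson0_pmf v) (k - a))"
    unfolding pmf_bind by (subst integral_measure_pmf[of "{..k}"]) (auto simp: pmf_shift split: if_splits)
  also have "\<dots> = (\<Sum>a\<le>k. (of_nat (k choose a) * u ^ a * v ^ (k - a)) * (exp (- (u + v)) / fact k))"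
    using assms exp_add[of "- u" "- v"] by (intro sum.cong refl) (simp add: pmf_poisson0 binomial_fact)
  also have "\<dots> = (u + v) ^ k * (exp (- (u + v)) / fact k)"
    by (simp add: binomial_ring sum_distrib_right sum_divide_distrib)
  finally show "pmf (bind_pmf (poisson0_pmf u) (\<lambda>a. map_pmf (\<lambda>b. a + b) (poisson0_pmf v))) k
      = pmf (poisson0_pmf (u + v)) k"
    using assms by (simp add: pmf_poisson0)
qed

lemma map_pmf_sum_poisson0:
  assumes "finite A" "\<And>B. B \<in> A \<Longrightarrow> 0 \<le> w B"
  shows "map_pmf (\<lambda>f. \<Sum>B\<in>A. f B) (Pi_pmf A 0 (\<lambda>B. poisson0_pmf (w B))) = poisson0_pmf (\<Sum>B\<in>A. w B)"
  using assms
proof (induction A rule: finite_induct)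
  case empty
  then show ?case by (simp add: poisson0_pmf_def)
next
  case (insert x A)
  have "map_pmf (\<lambda>f. \<Sum>B\<in>insert x A. f B) (Pi_pmf (insert x A) 0 (\<lambda>B. poisson0_pmf (w B)))
      = bind_pmf (poisson0_pmf (w x)) (\<lambda>a. map_pmf (\<lambda>f. \<Sum>B\<in>insert x A. (f(x := a)) B)
          (Pi_pmf A 0 (\<lambda>B. poisson0_pmf (w B))))"
    using insert.hyps by (simp add: Pi_pmf_insert' map_bind_pmf map_pmf_def bind_assoc_pmf bind_return_pmf)
  also have "(\<lambda>(a::nat) f. \<Sum>B\<in>insert x A. (f(x := a)) B) = (\<lambda>a f. a + (\<Sum>B\<in>A. f B))"
  proof (intro ext)
    fix a :: nat and f
    have "(\<Sum>B\<in>A. (f(x := a)) B) = (\<Sum>B\<in>A. f B)"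
      using insert.hyps by (intro sum.cong) auto
    then show "(\<Sum>B\<in>insert x A. (f(x := a)) B) = a + (\<Sum>B\<in>A. f B)"
      using insert.hyps by simp
  qed
  also have "(\<lambda>a. map_pmf (\<lambda>f. a + (\<Sum>B\<in>A. f B)) (Pi_pmf A 0 (\<lambda>B. poisson0_pmf (w B))))
      = (\<lambda>a. map_pmf (\<lambda>b. a + b) (poisson0_pmf (\<Sum>B\<in>A. w B)))"
    using insert.IH insert.prems by (simp flip: map_pmf_comp[of _ "\<lambda>f. \<Sum>B\<in>A. f B", unfolded o_def])
  finally show ?case
    using insert.hyps insert.prems by (simp add: poisson0_pmf_add sum_nonneg)
qed

lemma map_pmf_partial_sum_poisson0:
  assumes "finite T" "A \<subseteq> T" "\<And>B. B \<in> T \<Longrightarrow> 0 \<le> w B"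
  shows "map_pmf (\<lambda>f. \<Sum>B\<in>A. f B) (Pi_pmf T 0 (\<lambda>B. poisson0_pmf (w B))) = poisson0_pmf (\<Sum>B\<in>A. w B)"
proof -
  have "map_pmf (\<lambda>f. \<Sum>B\<in>A. f B) (Pi_pmf A 0 (\<lambda>B. poisson0_pmf (w B)))
      = map_pmf (\<lambda>f. \<Sum>B\<in>A. f B) (Pi_pmf T 0 (\<lambda>B. poisson0_pmf (w B)))"
    unfolding Pi_pmf_subset[OF assms(1,2)] map_pmf_comp
    by (intro map_pmf_cong refl sum.cong) auto
  then show ?thesis
    using assms map_pmf_sum_poisson0[of A w] by (metis finite_subset subsetD)
qed

lemma measurable_sum_nat:
  fixes f :: "'a \<Rightarrow> 'b \<Rightarrow> nat"
  assumes "\<And>i. i \<in> A \<Longrightarrow> f i \<in> measurable M (count_space UNIV)"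
  shows "(\<lambda>x. \<Sum>i\<in>A. f i x) \<in> measurable M (count_space UNIV)"
  using assms
proof (induction A rule: infinite_finite_induct)
  case (insert i A)
  then have [measurable]: "f i \<in> measurable M (count_space UNIV)"
      "(\<lambda>x. \<Sum>i\<in>A. f i x) \<in> measurable M (count_space UNIV)"
    by auto
  have "(\<lambda>x. f i x + (\<Sum>i\<in>A. f i x)) \<in> measurable M (count_space UNIV)"
    by measurable
  then show ?case using insert.hyps by simp
qed auto

text \<open>Independence is equality of the joint law with the product of the marginals, and both
  sides are the same before and after the push-forward. This moves independence from count vectors
  to configurations.\<close>

lemma indep_vars_distr:
  assumes "prob_space M" and g: "g \<in> measurable M N" and J: "finite J"
    and X: "\<And>i. i \<in> J \<Longrightarrow> X i \<in> measurable N (M' i)"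
    and ind: "prob_space.indep_vars M M' (\<lambda>i \<omega>. X i (g \<omega>)) J"
  shows "prob_space.indep_vars (distr M N g) M' X J"
proof -
  interpret prob_space M by fact
  interpret D: prob_space "distr M N g"
    by (rule prob_space_distr) (rule g)
  show ?thesis
  proof (cases "J = {}")
    \<comment> \<open>The characterisation by the joint law asks for a nonempty index set, while
      \<open>poisson_process\<close> includes \<open>r = 0\<close>.\<close>
    case True
    then show ?thesis
      by (simp add: D.indep_vars_def D.indep_sets_def)
  next
    case False
    have Xg: "random_variable (M' i) (\<lambda>\<omega>. X i (g \<omega>))" if "i \<in> J" for i
      using measurable_compose[OF g X[OF that]] .
    have XD: "D.random_variable (M' i) (X i)" if "i \<in> J" for i
      using X[OF that] by simp
    have "distr (distr M N g) (\<Pi>\<^sub>M i\<in>J. M' i) (\<lambda>x. \<lambda>i\<in>J. X i x)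
        = distr M (\<Pi>\<^sub>M i\<in>J. M' i) (\<lambda>\<omega>. \<lambda>i\<in>J. X i (g \<omega>))"
      using X g by (subst distr_distr) (auto intro!: measurable_restrict simp: o_def)
    also have "\<dots> = (\<Pi>\<^sub>M i\<in>J. distr M (M' i) (\<lambda>\<omega>. X i (g \<omega>)))"
      using indep_vars_iff_distr_eq_PiM'[OF False, where M' = M' and X = "\<lambda>i \<omega>. X i (g \<omega>)"] Xg ind by blast
    also have "\<dots> = (\<Pi>\<^sub>M i\<in>J. distr (distr M N g) (M' i) (X i))"
      using X g by (intro PiM_cong refl) (simp add: distr_distr o_def)
    finally show ?thesis
      using D.indep_vars_iff_distr_eq_PiM'[OF False, where M' = M' and X = X] XD by blast
  qed
qed

text \<open>Give the finitely many possible points independent Poisson multiplicities; the count in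
  \<open>A\<close> is then the sum of the multiplicities over \<open>A\<close>, which is Poisson by
  additivity.\<close>

lemma poisson_process_exists:
  fixes T :: "'b set" and w :: "'b \<Rightarrow> real"
  assumes T: "finite T" and w: "\<And>B. B \<in> T \<Longrightarrow> 0 \<le> w B"
  shows "\<exists>P. poisson_process P (\<lambda>y. y) (point_measure T (\<lambda>B. ennreal (w B)))"
proof -
  define p where "p = Pi_pmf T 0 (\<lambda>B. poisson0_pmf (w B))"
  define g :: "('b \<Rightarrow> nat) \<Rightarrow> 'b multiset" where "g f = (\<Sum>B\<in>T. replicate_mset (f B) B)" for f
  \<comment> \<open>The discrete sigma-algebra makes every count measurable.\<close>
  define N where "N = count_space {y :: 'b multiset. set_mset y \<subseteq> T}"
  define P where "P = distr (measure_pmf p) N g"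
  define \<nu> where "\<nu> = point_measure T (\<lambda>B. ennreal (w B))"
  have \<nu>: "sets \<nu> = Pow T" "space \<nu> = T"
    by (auto simp: \<nu>_def sets_point_measure space_point_measure)
  have m\<nu>: "measure \<nu> A = (\<Sum>B\<in>A. w B)" if "A \<subseteq> T" for A
  proof -
    have "emeasure \<nu> A = ennreal (\<Sum>B\<in>A. w B)"
      using that T w by (auto simp: \<nu>_def emeasure_point_measure_finite subset_iff intro!: sum_ennreal)
    then show ?thesis
      using that w by (simp add: measure_def subset_iff sum_nonneg)
  qed
  have "set_mset (g f) \<subseteq> T" for f
    using T by (auto simp: g_def set_mset_sum split: if_splits)
  then have g: "g \<in> measurable (measure_pmf p) N"
    by (simp add: N_def)
  have num_g: "num_points (\<lambda>y. y) A (g f) = (\<Sum>B\<in>A. f B)" if A: "A \<subseteq> T" for A f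
  proof -
    have "num_points (\<lambda>y. y) A (\<Sum>B\<in>U. replicate_mset (f B) B) = (\<Sum>B\<in>U \<inter> A. f B)" if "finite U" for U
      using that
    proof (induction U rule: finite_induct)
      case (insert x U)
      have "num_points (\<lambda>y. y) A (replicate_mset m x) = (if x \<in> A then m else 0)" for m
        by (induction m) auto
      with insert show ?case by (simp add: Int_insert_left)
    qed simp
    then show ?thesis
      using A T by (simp add: g_def Int_absorb1)
  qed
  have meas_N: "num_points (\<lambda>y. y) A \<in> measurable N (count_space UNIV)" for A
    by (simp add: N_def)
  have count: "measure P {y \<in> space P. num_points (\<lambda>y. y) A y = k}
      = measure \<nu> A ^ k / fact k * exp (- measure \<nu> A)" if A: "A \<subseteq> T" for A k
  proof -
    have "measure P {y \<in> space P. num_points (\<lambda>y. y) A y = k}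
        = measure (measure_pmf p) (g -` {y \<in> space P. num_points (\<lambda>y. y) A y = k} \<inter> space (measure_pmf p))"
      unfolding P_def by (intro measure_distr g) (auto simp: N_def)
    also have "g -` {y \<in> space P. num_points (\<lambda>y. y) A y = k} \<inter> space (measure_pmf p)
        = (\<lambda>f. \<Sum>B\<in>A. f B) -` {k}"
      using num_g[OF A] measurable_space[OF g] by (auto simp: P_def)
    also have "measure (measure_pmf p) \<dots> = pmf (map_pmf (\<lambda>f. \<Sum>B\<in>A. f B) p) k"
      by (simp add: pmf_map)
    also have "\<dots> = (\<Sum>B\<in>A. w B) ^ k / fact k * exp (- (\<Sum>B\<in>A. w B))"
      unfolding p_def using T A w
      by (subst map_pmf_partial_sum_poisson0) (auto simp: pmf_poisson0 sum_nonneg subset_iff)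
    finally show ?thesis by (simp add: m\<nu>[OF A])
  qed
  have indep: "prob_space.indep_vars P (\<lambda>_. count_space UNIV) (\<lambda>j. num_points (\<lambda>y. y) (A j)) {..<r}"
    if A: "A ` {..<r::nat} \<subseteq> Pow T" "disjoint_family_on A {..<r}" for A r
    unfolding P_def
  proof (rule indep_vars_distr[OF measure_pmf.prob_space_axioms g])
    \<comment> \<open>Disjoint sets \<open>A j\<close> involve disjoint blocks of independent
      coordinates.\<close>
    have "prob_space.indep_vars (measure_pmf p) (\<lambda>j. \<Pi>\<^sub>M B\<in>A j. count_space UNIV) (\<lambda>j f. restrict (\<lambda>B. f B) (A j)) {..<r}"
      using A unfolding p_def
      by (intro prob_space.indep_vars_restrict[OF measure_pmf.prob_space_axioms indep_vars_Pi_pmf[OF T]]) auto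
    then have "prob_space.indep_vars (measure_pmf p) (\<lambda>_. count_space UNIV)
        (\<lambda>j f. \<Sum>B\<in>A j. restrict (\<lambda>B. f B) (A j) B) {..<r}"
      by (rule prob_space.indep_vars_compose2[OF measure_pmf.prob_space_axioms]) (auto intro!: measurable_sum_nat measurable_component_singleton)
    then show "prob_space.indep_vars (measure_pmf p) (\<lambda>_. count_space UNIV) (\<lambda>j f. num_points (\<lambda>y. y) (A j) (g f)) {..<r}"
      by (rule prob_space.indep_vars_cong[OF measure_pmf.prob_space_axioms, THEN iffD1, rotated 3]) (use A num_g in \<open>auto simp: image_subset_iff\<close>)
  qed (auto intro: meas_N)
  have "finite_measure \<nu>"
    using T by (intro finite_measureI) (simp add: \<nu>(2), simp add: \<nu>_def emeasure_point_measure_finite)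
  moreover have "prob_space P"
    unfolding P_def by (rule measure_pmf.prob_space_distr) (rule g)
  moreover have "\<forall>y\<in>space P. set_mset y \<subseteq> space \<nu>"
    by (simp add: P_def N_def \<nu>)
  moreover have "num_points (\<lambda>y. y) A \<in> measurable P (count_space UNIV)" for A
    using meas_N by (simp add: P_def)
  ultimately have "poisson_process P (\<lambda>y. y) \<nu>"
    unfolding poisson_process_def using count indep \<nu> by auto
  then show ?thesis
    unfolding \<nu>_def by blast
qed

section \<open>A criterion for representability\<close>

text \<open>Passing from \<open>T\<close> to its complement \<open>U\<close> in \<open>A\<close>
  turns the Moebius sign into \<open>(-1) ^ card U\<close> and the index into
  \<open>card S - card A + card U\<close>.\<close>

lemma sum_Pow_Mobius:
  assumes "finite S" "A \<subseteq> S"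
  shows "(\<Sum>T\<in>Pow A. (- 1) ^ (card A - card T) * \<phi> (card S - card T))
    = alt_diff (card A) \<phi> (card S - card A)"
proof -
  have A: "finite A" "card A \<le> card S"
    using assms finite_subset card_mono by auto
  have "(\<Sum>T\<in>Pow A. (- 1) ^ (card A - card T) * \<phi> (card S - card T))
      = (\<Sum>U\<in>Pow A. (- 1) ^ card U * \<phi> (card S - card A + card U))"
  proof (rule sum.reindex_bij_witness[of _ "\<lambda>U. A - U" "\<lambda>T. A - T"])
    fix T assume T: "T \<in> Pow A"
    then have "card (A - T) = card A - card T" "card T \<le> card A"
      using A by (auto simp: card_Diff_subset finite_subset card_mono)
    then show "(- 1) ^ card (A - T) * \<phi> (card S - card A + card (A - T))
        = (- 1) ^ (card A - card T) * \<phi> (card S - card T)"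
      using A by simp
  qed auto
  then show ?thesis
    using sum_Pow_alternating[OF A(1)] by simp
qed

text \<open>Void probabilities fix the intensity of the sets meeting \<open>K\<close> as
  \<open>- ln (v (card K))\<close>, and Moebius inversion then fixes the mass of each singleton as
  an alternating difference. Conversely, nonnegative differences serve as masses, and the resulting
  process has the right void probabilities, hence the right law.\<close>

lemma poisson_representable_iff:
  fixes S :: "'i set" and v :: "nat \<Rightarrow> real"
  assumes S: "finite S" and M: "prob_space M" and X: "X \<in> measurable M (binary_space S)"
    and void: "\<And>K. K \<subseteq> S \<Longrightarrow> void_probability S M X K = v (card K)"
    and pos: "\<And>k. 0 < v k" and v0: "v 0 = 1"
  shows "poisson_representable S M X
    \<longleftrightarrow> (\<forall>a\<in>{1..card S}. 0 \<le> alt_diff a (\<lambda>k. ln (v k)) (card S - a))"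
proof -
  \<comment> \<open>The mass that an intensity must give to the nonempty subsets of
    \<open>A\<close>: that of the sets meeting \<open>S\<close> minus that of the sets meeting
    \<open>S - A\<close>.\<close>
  define g where "g A = ln (v (card S - card A)) - ln (v (card S))" for A :: "'i set"
  have Mobius: "(\<Sum>T\<in>Pow A. (- 1) ^ (card A - card T) * g T)
      = alt_diff (card A) (\<lambda>k. ln (v k)) (card S - card A)" if "A \<subseteq> S" "A \<noteq> {}" for A
  proof -
    have "1 \<le> card A"
      using that S by (simp add: Suc_le_eq card_gt_0_iff finite_subset)
    then show ?thesis
      using sum_Pow_Mobius[OF S that(1), of "\<lambda>k. ln (v k) + - ln (v (card S))"]
      unfolding alt_diff_add by (simp add: g_def alt_diff_const)
  qed
  show ?thesis
  proof
    assume "poisson_representable S M X"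
    then obtain \<nu> :: "'i set measure" and P :: "'i set multiset measure"
      where \<nu>: "sets \<nu> = Pow (Pow S - {{}})" and P: "poisson_process P (\<lambda>y. y) \<nu>"
        and eq: "distr M (binary_space S) X = distr P (binary_space S) (covered S)"
      unfolding poisson_representable_def by blast
    interpret \<nu>: finite_measure \<nu>
      using P by (simp add: poisson_process_def)
    have hit: "measure \<nu> {B \<in> Pow S. B \<inter> K \<noteq> {}} = - ln (v (card K))" if K: "K \<subseteq> S" for K
    proof -
      have "exp (- measure \<nu> {B \<in> Pow S. B \<inter> K \<noteq> {}}) = v (card K)"
        using poisson_void_probability(2)[OF S \<nu> P K] void[OF K] eq
        by (simp add: void_probability_def)
      from arg_cong[OF this, of ln] show ?thesis
        by simp
    qed
    \<comment> \<open>The value 0 at the empty set, which is no point of \<open>\<nu>\<close>, lets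
      Moebius inversion run over full power sets.\<close>
    define f where "f A = (if A \<in> Pow S - {{}} then measure \<nu> {A} else 0)" for A
    have g: "sum f (Pow A) = g A" if A: "A \<subseteq> S" for A
    proof -
      have fin: "finite (Pow S)" "finite (Pow A)"
        using S A by (auto intro: finite_subset)
      have "sum f (Pow A) = (\<Sum>B\<in>Pow A - {{}}. measure \<nu> {B})"
        using A fin by (intro sum.mono_neutral_cong_right) (auto simp: f_def)
      also have "\<dots> = measure \<nu> (Pow A - {{}})"
        using A fin \<nu> by (subst \<nu>.finite_measure_eq_sum_singleton) auto
      also have "\<dots> = measure \<nu> {B \<in> Pow S. B \<inter> S \<noteq> {}} - measure \<nu> {B \<in> Pow S. B \<inter> (S - A) \<noteq> {}}"
      proof -
        have "{B \<in> Pow S. B \<inter> S \<noteq> {}} = (Pow A - {{}}) \<union> {B \<in> Pow S. B \<inter> (S - A) \<noteq> {}}"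
          using A by auto
        moreover have "measure \<nu> ((Pow A - {{}}) \<union> {B \<in> Pow S. B \<inter> (S - A) \<noteq> {}})
            = measure \<nu> (Pow A - {{}}) + measure \<nu> {B \<in> Pow S. B \<inter> (S - A) \<noteq> {}}"
          using A \<nu> by (intro \<nu>.finite_measure_Union) auto
        ultimately show ?thesis by simp
      qed
      also have "\<dots> = g A"
        unfolding hit[OF subset_refl] hit[OF Diff_subset] g_def
        using A S by (simp add: card_Diff_subset[OF finite_subset[OF A S] A])
      finally show ?thesis .
    qed
    show "\<forall>a\<in>{1..card S}. 0 \<le> alt_diff a (\<lambda>k. ln (v k)) (card S - a)"
    proof
      fix a assume a: "a \<in> {1..card S}"
      then obtain A where A: "A \<subseteq> S" "card A = a"
        using obtain_subset_with_card_n[of a S] by auto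
      have "A \<noteq> {}"
        using A a by auto
      have "f A = (\<Sum>T\<in>Pow A. (- 1) ^ (card A - card T) * sum f (Pow T))"
        using A S by (intro inclusion_exclusion_mobius) (auto intro: finite_subset)
      also have "\<dots> = (\<Sum>T\<in>Pow A. (- 1) ^ (card A - card T) * g T)"
        using A g by (intro sum.cong refl) auto
      also have "\<dots> = alt_diff a (\<lambda>k. ln (v k)) (card S - a)"
        using A Mobius[OF A(1) \<open>A \<noteq> {}\<close>] by simp
      finally have "f A = alt_diff a (\<lambda>k. ln (v k)) (card S - a)" .
      moreover have "0 \<le> f A"
        by (simp add: f_def)
      ultimately show "0 \<le> alt_diff a (\<lambda>k. ln (v k)) (card S - a)"
        by simp
    qed
  next
    assume nonneg: "\<forall>a\<in>{1..card S}. 0 \<le> alt_diff a (\<lambda>k. ln (v k)) (card S - a)"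
    \<comment> \<open>\<open>h\<close> puts the signs in the form in which inclusion-exclusion is
      symmetric; \<open>w\<close> is the Moebius inverse of \<open>g\<close>, with
      \<open>w {} = g {} = 0\<close>.\<close>
    define h where "h A = (\<Sum>T\<in>Pow A. (- 1) ^ card T * g T)" for A
    define w where "w A = (- 1) ^ card A * h A" for A
    define \<nu> where "\<nu> = point_measure (Pow S - {{}}) (\<lambda>B. ennreal (w B))"
    have w: "sum w (Pow A) = g A" if "finite A" for A
      unfolding w_def using that by (intro inclusion_exclusion_symmetric[symmetric]) (auto simp: h_def)
    have w_nonneg: "0 \<le> w A" if A: "A \<in> Pow S - {{}}" for A
    proof -
      have fin: "finite A"
        using A S by (auto intro: finite_subset)
      have "w A = (\<Sum>T\<in>Pow A. (- 1) ^ (card A - card T) * g T)"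
        unfolding w_def h_def sum_distrib_left
      proof (intro sum.cong refl)
        fix T assume "T \<in> Pow A"
        then have "card T \<le> card A"
          using fin by (auto intro: card_mono)
        then show "(- 1) ^ card A * ((- 1) ^ card T * g T) = (- 1) ^ (card A - card T) * g T"
          by (simp add: neg_one_power_add_eq_neg_one_power_diff flip: power_add mult.assoc)
      qed
      also have "\<dots> = alt_diff (card A) (\<lambda>k. ln (v k)) (card S - card A)"
        using A Mobius by auto
      also have "\<dots> \<ge> 0"
      proof -
        have "card A \<in> {1..card S}"
          using A S fin by (auto simp: Suc_le_eq card_gt_0_iff intro: card_mono)
        then show ?thesis using nonneg by blast
      qed
      finally show ?thesis .
    qed
    obtain P where P: "poisson_process P (\<lambda>y. y) \<nu>"
      using poisson_process_exists[of "Pow S - {{}}" w] S w_nonneg unfolding \<nu>_def by auto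
    have sets: "sets \<nu> = Pow (Pow S - {{}})"
      by (simp add: \<nu>_def sets_point_measure)
    have sf: "sigma_finite_measure \<nu>"
      using P by (auto simp: poisson_process_def finite_measure_def)
    have void_P: "void_probability S P (covered S) K = v (card K)" if K: "K \<subseteq> S" for K
    proof -
      have "measure \<nu> {B \<in> Pow S. B \<inter> K \<noteq> {}} = (\<Sum>B\<in>{B \<in> Pow S. B \<inter> K \<noteq> {}}. w B)"
      proof -
        have "emeasure \<nu> {B \<in> Pow S. B \<inter> K \<noteq> {}} = (\<Sum>B\<in>{B \<in> Pow S. B \<inter> K \<noteq> {}}. ennreal (w B))"
          unfolding \<nu>_def using S by (intro emeasure_point_measure_finite) auto
        also have "\<dots> = ennreal (\<Sum>B\<in>{B \<in> Pow S. B \<inter> K \<noteq> {}}. w B)"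
          using w_nonneg by (intro sum_ennreal) auto
        finally show ?thesis
          using w_nonneg by (intro measure_eq_emeasure_eq_ennreal sum_nonneg) auto
      qed
      also have "\<dots> = sum w (Pow S) - sum w (Pow (S - K))"
      proof -
        have "{B \<in> Pow S. B \<inter> K \<noteq> {}} = Pow S - Pow (S - K)"
          by auto
        then show ?thesis
          using S by (simp only:) (intro sum_diff, auto)
      qed
      also have "\<dots> = - ln (v (card K))"
        using S K card_mono[OF S K] by (simp add: w g_def v0 card_Diff_subset finite_subset)
      finally show ?thesis
        using poisson_void_probability(2)[OF S sets P K] pos by simp
    qed
    have "distr M (binary_space S) X = distr P (binary_space S) (covered S)"
    proof (rule binary_space_measure_eqI[OF S])
      show "prob_space (distr M (binary_space S) X)"
        by (rule prob_space.prob_space_distr[OF M X])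
      show "prob_space (distr P (binary_space S) (covered S))"
        using P poisson_void_probability(1)[OF S sets P]
        by (intro prob_space.prob_space_distr) (auto simp: poisson_process_def)
      show "measure (distr M (binary_space S) X) (all_zero S K)
          = measure (distr P (binary_space S) (covered S)) (all_zero S K)" if "K \<subseteq> S" for K
        using void[OF that] void_P[OF that] by (simp add: void_probability_def)
    qed auto
    then show "poisson_representable S M X"
      unfolding poisson_representable_def using M X sets sf P by blast
  qed
qed

section \<open>Bernoulli mixtures\<close>

lemma
  assumes p: "0 \<le> p" "p \<le> 1"
  shows sets_bernoulli_product: "sets (bernoulli_product p) = sets (binary_space {1..})"
    and prob_space_bernoulli_product: "prob_space (bernoulli_product p)"
    and emeasure_bernoulli_product_all_zero:
      "finite K \<Longrightarrow> K \<subseteq> {1..} \<Longrightarrow>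
        emeasure (bernoulli_product p) (all_zero {1..} K) = ennreal ((1 - p) ^ card K)"
proof -
  interpret product_prob_space "\<lambda>_::nat. measure_pmf (bernoulli_pmf p)" "{1..}"
    by standard
  show sets: "sets (bernoulli_product p) = sets (binary_space {1..})"
    unfolding bernoulli_product_def by (intro sets_PiM_cong) auto
  show "prob_space (bernoulli_product p)"
    unfolding bernoulli_product_def by (intro prob_space_PiM measure_pmf.prob_space_axioms)
  show "emeasure (bernoulli_product p) (all_zero {1..} K) = ennreal ((1 - p) ^ card K)"
    if K: "finite K" "K \<subseteq> {1..}"
  proof -
    have "all_zero {1..} K
        = {f \<in> space (PiM {1..} (\<lambda>_. measure_pmf (bernoulli_pmf p))). \<forall>i\<in>K. f i \<in> {False}}"
      by (auto simp: all_zero_def space_PiM)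
    then have "emeasure (bernoulli_product p) (all_zero {1..} K)
        = (\<Prod>i\<in>K. emeasure (measure_pmf (bernoulli_pmf p)) {False})"
      unfolding bernoulli_product_def using emeasure_PiM_Collect[OF K(2,1), of "\<lambda>_. {False}"] by simp
    also have "emeasure (measure_pmf (bernoulli_pmf p)) {False} = ennreal (1 - p)"
      using p by (simp add: emeasure_pmf_single)
    finally show ?thesis
      using p by (simp add: ennreal_power)
  qed
qed

lemma
  assumes "admissible_points m x" "i \<in> {1..m}"
  shows admissible_points_nonneg: "0 \<le> x i" and admissible_points_le_1: "x i \<le> 1"
proof -
  have anti: "x k \<le> x j" if "1 \<le> j" "j \<le> k" "k \<le> m" for j k
    using assms(1) that by (cases "j = k") (auto simp: admissible_points_def less_eq_real_def)
  show "0 \<le> x i" "x i \<le> 1"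
    using anti[of i m] anti[of 1 i] assms by (auto simp: admissible_points_def)
qed

lemma
  assumes x: "admissible_points m x" and q: "0 < q" "q \<le> 1" and \<alpha>: "admissible_weights m \<alpha>"
  shows prob_space_bernoulli_mixture: "prob_space (bernoulli_mixture m x q \<alpha>)"
    and sets_bernoulli_mixture: "sets (bernoulli_mixture m x q \<alpha>) = sets (binary_space {1..})"
    and measure_bernoulli_mixture_all_zero:
      "finite K \<Longrightarrow> K \<subseteq> {1..} \<Longrightarrow>
        measure (bernoulli_mixture m x q \<alpha>) (all_zero {1..} K)
          = q ^ card K * (\<Sum>i=1..m. \<alpha> i * x i ^ card K)"
proof -
  define \<mu> where "\<mu> A = (\<Sum>i=1..m. ennreal (\<alpha> i) * emeasure (bernoulli_product (1 - q * x i)) A)" for A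
  have p: "0 \<le> 1 - q * x i" "1 - q * x i \<le> 1" if "i \<in> {1..m}" for i
    using admissible_points_nonneg[OF x that] admissible_points_le_1[OF x that] q
    by (auto intro: mult_le_one)
  have \<alpha>0: "0 \<le> \<alpha> i" if "i \<in> {1..m}" for i
    using \<alpha> that by (auto simp: admissible_weights_def less_imp_le)
  show sets: "sets (bernoulli_mixture m x q \<alpha>) = sets (binary_space {1..})"
    unfolding bernoulli_mixture_def by (simp add: sets.sigma_sets_eq sets.space_closed)
  have \<mu>: "emeasure (bernoulli_mixture m x q \<alpha>) A = \<mu> A" if "A \<in> sets (binary_space {1..})" for A
  proof (rule emeasure_measure_of)
    show "bernoulli_mixture m x q \<alpha> = measure_of (space (binary_space {1..})) (sets (binary_space {1..})) \<mu>"
      unfolding bernoulli_mixture_def \<mu>_def ..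
    \<comment> \<open>\<open>measure_of\<close> falls back to the zero measure for set functions
      that are not measures, so this must be checked before the weighted sum can be
      evaluated.\<close>
    show "countably_additive (sets (bernoulli_mixture m x q \<alpha>)) \<mu>"
    proof (rule countably_additiveI)
      fix A :: "nat \<Rightarrow> (nat \<Rightarrow> bool) set"
      assume A: "range A \<subseteq> sets (bernoulli_mixture m x q \<alpha>)" "disjoint_family A"
      have "(\<Sum>n. \<mu> (A n))
          = (\<Sum>i=1..m. \<Sum>n. ennreal (\<alpha> i) * emeasure (bernoulli_product (1 - q * x i)) (A n))"
        unfolding \<mu>_def by (rule suminf_sum) auto
      also have "\<dots> = \<mu> (\<Union> (range A))"
        unfolding \<mu>_def
      proof (intro sum.cong refl)
        fix i assume i: "i \<in> {1..m}"
        have "(\<Sum>n. emeasure (bernoulli_product (1 - q * x i)) (A n))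
            = emeasure (bernoulli_product (1 - q * x i)) (\<Union> (range A))"
          using A sets_bernoulli_product[OF p[OF i]] sets by (intro suminf_emeasure) auto
        then show "(\<Sum>n. ennreal (\<alpha> i) * emeasure (bernoulli_product (1 - q * x i)) (A n))
            = ennreal (\<alpha> i) * emeasure (bernoulli_product (1 - q * x i)) (\<Union> (range A))"
          by (simp add: ennreal_suminf_cmult)
      qed
      finally show "(\<Sum>n. \<mu> (A n)) = \<mu> (\<Union> (range A))" .
    qed
    show "positive (sets (bernoulli_mixture m x q \<alpha>)) \<mu>"
      by (simp add: positive_def \<mu>_def)
  qed (use that sets sets.space_closed in auto)
  show "prob_space (bernoulli_mixture m x q \<alpha>)"
  proof (rule prob_spaceI)
    have space: "space (bernoulli_mixture m x q \<alpha>) = space (binary_space {1..})"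
      using sets by (rule sets_eq_imp_space_eq)
    have "emeasure (bernoulli_product (1 - q * x i)) (space (binary_space {1..})) = 1" if "i \<in> {1..m}" for i
      using prob_space.emeasure_space_1[OF prob_space_bernoulli_product[OF p[OF that]]]
        sets_eq_imp_space_eq[OF sets_bernoulli_product[OF p[OF that]]] by simp
    then have "\<mu> (space (binary_space {1..})) = (\<Sum>i=1..m. ennreal (\<alpha> i))"
      unfolding \<mu>_def by (intro sum.cong) auto
    also have "\<dots> = ennreal (\<Sum>i=1..m. \<alpha> i)"
      using \<alpha>0 by (rule sum_ennreal)
    finally show "emeasure (bernoulli_mixture m x q \<alpha>) (space (bernoulli_mixture m x q \<alpha>)) = 1"
      using \<alpha> by (simp add: space \<mu> admissible_weights_def)
  qed
  show "measure (bernoulli_mixture m x q \<alpha>) (all_zero {1..} K)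
      = q ^ card K * (\<Sum>i=1..m. \<alpha> i * x i ^ card K)" if K: "finite K" "K \<subseteq> {1..}"
  proof -
    have nn: "0 \<le> \<alpha> i * (q * x i) ^ card K" if "i \<in> {1..m}" for i
      using \<alpha>0[OF that] admissible_points_nonneg[OF x that] q by simp
    have "emeasure (bernoulli_mixture m x q \<alpha>) (all_zero {1..} K) = \<mu> (all_zero {1..} K)"
      using K by (intro \<mu> all_zero_measurable)
    also have "\<dots> = (\<Sum>i=1..m. ennreal (\<alpha> i * (q * x i) ^ card K))"
      unfolding \<mu>_def using K p \<alpha>0 admissible_points_nonneg[OF x] q
      by (intro sum.cong refl) (subst emeasure_bernoulli_product_all_zero, auto simp: ennreal_mult)
    also have "\<dots> = ennreal (\<Sum>i=1..m. \<alpha> i * (q * x i) ^ card K)"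
      using nn by (rule sum_ennreal)
    finally have "measure (bernoulli_mixture m x q \<alpha>) (all_zero {1..} K)
        = (\<Sum>i=1..m. \<alpha> i * (q * x i) ^ card K)"
      by (rule measure_eq_emeasure_eq_ennreal[rotated]) (rule sum_nonneg[OF nn])
    then show ?thesis
      by (simp add: power_mult_distrib sum_distrib_left mult_ac)
  qed
qed

text \<open>The condition of order 1 says that \<open>v n \<le> v (n - 1)\<close>, which always
  holds; from order 2 on, \<open>q ^ k\<close> adds a linear sequence to the logarithm and
  disappears. Hence the criterion is free of \<open>q\<close>.\<close>

lemma mixture_representable_iff:
  assumes mix: "mixture_process m x q \<alpha> M X" and n: "1 \<le> n"
  shows "poisson_representable {1..n} M (restr X n)
    \<longleftrightarrow> (\<forall>a\<in>{2..n}. 0 \<le> alt_diff a (\<lambda>k. ln (\<Sum>i=1..m. \<alpha> i * x i ^ k)) (n - a))"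
proof -
  define L where "L k = (\<Sum>i=1..m. \<alpha> i * x i ^ k)" for k
  define v where "v k = q ^ k * L k" for k
  have x: "admissible_points m x" and q: "0 < q" "q \<le> 1" and \<alpha>: "admissible_weights m \<alpha>"
    and law: "has_law M X (bernoulli_mixture m x q \<alpha>)"
    using mix by (auto simp: mixture_process_def)
  have nn: "0 \<le> \<alpha> i * x i ^ k" if "i \<in> {1..m}" for i k
    using \<alpha> that admissible_points_nonneg[OF x that] by (auto simp: admissible_weights_def less_imp_le)
  \<comment> \<open>The component at \<open>x 1 = 1\<close> keeps every moment positive, even if
    \<open>x m = 0\<close>.\<close>
  have L_pos: "0 < L k" for k
    unfolding L_def using nn x \<alpha>
    by (intro sum_pos2[of _ 1]) (auto simp: admissible_points_def admissible_weights_def)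
  have L_Suc: "L (Suc k) \<le> L k" for k
    unfolding L_def
  proof (rule sum_mono)
    fix i assume i: "i \<in> {1..m}"
    show "\<alpha> i * x i ^ Suc k \<le> \<alpha> i * x i ^ k"
      using mult_left_mono[OF admissible_points_le_1[OF x i] nn[OF i, of k]] by (simp add: mult_ac)
  qed
  have v_pos: "0 < v k" for k
    using L_pos q by (simp add: v_def)
  have M: "prob_space M" and X: "X \<in> measurable M (binary_space {1..})"
    and distr: "distr M (binary_space {1..}) X = bernoulli_mixture m x q \<alpha>"
    using law by (auto simp: has_law_def)
  have "(\<lambda>f. restrict f {1..n}) \<in> measurable (binary_space {1..}) (binary_space {1..n})"
    by (rule measurable_restrict_subset) auto
  from measurable_compose[OF X this]
  have Xn: "restr X n \<in> measurable M (binary_space {1..n})"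
    by (simp add: restr_def[abs_def])
  have void: "void_probability {1..n} M (restr X n) K = v (card K)" if K: "K \<subseteq> {1..n}" for K
  proof -
    have K': "finite K" "K \<subseteq> {1..}"
      using K by (auto intro: finite_subset)
    have "void_probability {1..n} M (restr X n) K = measure M (restr X n -` all_zero {1..n} K \<inter> space M)"
      unfolding void_probability_def using K K' by (intro measure_distr Xn all_zero_measurable)
    also have "restr X n -` all_zero {1..n} K \<inter> space M = X -` all_zero {1..} K \<inter> space M"
      using measurable_space[OF X] measurable_space[OF Xn] K by (auto simp: all_zero_def restr_def subset_iff)
    also have "measure M \<dots> = measure (distr M (binary_space {1..}) X) (all_zero {1..} K)"
      using K' by (intro measure_distr[symmetric] X all_zero_measurable)
    also have "\<dots> = v (card K)"
      unfolding distr v_def L_def by (rule measure_bernoulli_mixture_all_zero[OF x q \<alpha> K'])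
    finally show ?thesis .
  qed
  \<comment> \<open>Here \<open>0 ^ 0 = 1\<close> covers the case \<open>x m = 0\<close>.\<close>
  have "v 0 = 1"
    using \<alpha> by (simp add: v_def L_def admissible_weights_def)
  then have "poisson_representable {1..n} M (restr X n)
      \<longleftrightarrow> (\<forall>a\<in>{1..n}. 0 \<le> alt_diff a (\<lambda>k. ln (v k)) (n - a))"
    using poisson_representable_iff[OF _ M Xn void v_pos] by simp
  also have "\<dots> \<longleftrightarrow> (\<forall>a\<in>{2..n}. 0 \<le> alt_diff a (\<lambda>k. ln (v k)) (n - a))"
  proof -
    have "v n \<le> v (n - 1)"
    proof -
      have "q ^ n * L n \<le> q ^ (n - 1) * L (n - 1)"
        using q n L_Suc[of "n - 1"] L_pos[of n] by (intro mult_mono power_decreasing) auto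
      then show ?thesis by (simp add: v_def)
    qed
    then have "0 \<le> alt_diff 1 (\<lambda>k. ln (v k)) (n - 1)"
      using n v_pos by simp
    moreover have "{1..n} = insert 1 {2..n}"
      using n by auto
    ultimately show ?thesis by simp
  qed
  also have "\<dots> \<longleftrightarrow> (\<forall>a\<in>{2..n}. 0 \<le> alt_diff a (\<lambda>k. ln (L k)) (n - a))"
  proof (intro ball_cong refl)
    fix a assume "a \<in> {2..n}"
    moreover have "(\<lambda>k. ln (v k)) = (\<lambda>k. real k * ln q + ln (L k))"
      using q L_pos by (auto simp: v_def ln_mult ln_realpow less_imp_neq[symmetric])
    ultimately show "(0 \<le> alt_diff a (\<lambda>k. ln (v k)) (n - a)) = (0 \<le> alt_diff a (\<lambda>k. ln (L k)) (n - a))"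
      by (simp add: alt_diff_add alt_diff_linear)
  qed
  finally show ?thesis
    unfolding L_def .
qed

section \<open>Sufficient conditions: small second point or large first weight\<close>

lemma moment_sequence_normalized:
  assumes "admissible_points m x" "admissible_weights m \<alpha>" "1 \<le> m"
  shows "moment_sequence {2..m} (\<lambda>i. \<alpha> i / \<alpha> 1) x"
  using assms admissible_points_nonneg[of m x] admissible_points_le_1[of m x]
  by unfold_locales (auto simp: admissible_weights_def less_imp_le)

text \<open>As \<open>x 1 = 1\<close>, the factor \<open>\<alpha> 1\<close> comes out of every
  moment, and its logarithm is a constant that differences kill. The remaining components then have
  total mass \<open>1 / \<alpha> 1 - 1\<close>.\<close>

lemma
  assumes x: "admissible_points m x" and \<alpha>: "admissible_weights m \<alpha>"
  defines "r \<equiv> moment_sequence.moment {2..m} (\<lambda>i. \<alpha> i / \<alpha> 1) x"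
  shows one_plus_moment_0: "1 + r 0 = 1 / \<alpha> 1"
    and alt_diff_ln_mixture: "1 \<le> a \<Longrightarrow>
      alt_diff a (\<lambda>k. ln (\<Sum>i=1..m. \<alpha> i * x i ^ k)) k = alt_diff a (\<lambda>k. ln (1 + r k)) k"
proof -
  have m: "1 \<le> m" and x1: "x 1 = 1"
    using x by (auto simp: admissible_points_def)
  interpret moment_sequence "{2..m}" "\<lambda>i. \<alpha> i / \<alpha> 1" x
    using x \<alpha> m by (rule moment_sequence_normalized)
  have \<alpha>1: "0 < \<alpha> 1" and sum1: "(\<Sum>i=1..m. \<alpha> i) = 1"
    using \<alpha> m by (auto simp: admissible_weights_def)
  have L: "(\<Sum>i=1..m. \<alpha> i * x i ^ k) = \<alpha> 1 * (1 + r k)" for k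
  proof -
    have "{1..m} = insert 1 {2..m}"
      using m by auto
    then have "(\<Sum>i=1..m. \<alpha> i * x i ^ k) = \<alpha> 1 + (\<Sum>i=2..m. \<alpha> i * x i ^ k)"
      using x1 by simp
    also have "(\<Sum>i=2..m. \<alpha> i * x i ^ k) = \<alpha> 1 * r k"
      unfolding r_def moment_def sum_distrib_left using \<alpha>1 by (intro sum.cong) auto
    finally show ?thesis by (simp add: algebra_simps)
  qed
  show "1 + r 0 = 1 / \<alpha> 1"
    using L[of 0] sum1 \<alpha>1 by (simp add: field_simps)
  assume a: "1 \<le> a"
  have "ln (\<Sum>i=1..m. \<alpha> i * x i ^ k) = ln (\<alpha> 1) + ln (1 + r k)" for k
    using \<alpha>1 moment_nonneg[of k] unfolding L by (subst ln_mult) (auto simp: r_def add_pos_nonneg)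
  then show "alt_diff a (\<lambda>k. ln (\<Sum>i=1..m. \<alpha> i * x i ^ k)) k = alt_diff a (\<lambda>k. ln (1 + r k)) k"
    using a by (simp add: alt_diff_add alt_diff_const)
qed

text \<open>In \<open>alt_diff_ln_moment_ge\<close> take \<open>d = x 2\<close>; since
  \<open>1 / (1 + moment 0) = \<alpha> 1\<close>, it suffices that
  \<open>2 ^ a * x 2 \<le> \<alpha> 1\<close> for all orders \<open>a \<le> n\<close>.\<close>

lemma representable_if_second_point_small:
  assumes n: "1 \<le> n" and mix: "mixture_process m x q \<alpha> M X" and m: "2 \<le> m"
    and small: "x 2 \<le> \<alpha> 1 / 2 ^ n"
  shows "poisson_representable {1..n} M (restr X n)"
  unfolding mixture_representable_iff[OF mix n]
proof
  fix a assume a: "a \<in> {2..n}"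
  have x: "admissible_points m x" and \<alpha>: "admissible_weights m \<alpha>"
    using mix by (auto simp: mixture_process_def)
  interpret moment_sequence "{2..m}" "\<lambda>i. \<alpha> i / \<alpha> 1" x
    using x \<alpha> m by (intro moment_sequence_normalized) auto
  have le: "x i \<le> x 2" if "i \<in> {2..m}" for i
    using x that m by (cases "i = 2") (auto simp: admissible_points_def less_imp_le)
  have "0 \<le> x 2"
    using admissible_points_nonneg[OF x, of 2] m by simp
  then have "2 ^ a * x 2 \<le> 2 ^ n * x 2"
    using a by (intro mult_right_mono power_increasing) auto
  also have "\<dots> \<le> \<alpha> 1"
    using small by (simp add: field_simps)
  finally have "0 \<le> moment (n - a) * (\<alpha> 1 - 2 ^ a * x 2)"
    using moment_nonneg by simp
  also have "\<dots> \<le> alt_diff a (\<lambda>k. ln (1 + moment k)) (n - a)"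
    using alt_diff_ln_moment_ge[OF le \<open>0 \<le> x 2\<close>, of "n - a" a] one_plus_moment_0[OF x \<alpha>] by simp
  finally show "0 \<le> alt_diff a (\<lambda>k. ln (\<Sum>i=1..m. \<alpha> i * x i ^ k)) (n - a)"
    using alt_diff_ln_mixture[OF x \<alpha>] a by simp
qed

text \<open>As \<open>\<alpha> 1 \<ge> 1/2\<close>, the remaining mass
  \<open>(1 - \<alpha> 1) / \<alpha> 1\<close> is at most \<open>2 * (1 - \<alpha> 1)\<close>, so
  the threshold yields the smallness condition of \<open>alt_diff_ln_moment_nonneg\<close> for every
  order up to \<open>n\<close>.\<close>

lemma representable_if_first_weight_large:
  assumes n: "1 \<le> n" and mix: "mixture_process m x q \<alpha> M X"
    and large: "1 - 1 / (4 * 4 ^ n) < \<alpha> 1"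
  shows "poisson_representable {1..n} M (restr X n)"
  unfolding mixture_representable_iff[OF mix n]
proof
  fix a assume a: "a \<in> {2..n}"
  have x: "admissible_points m x" and \<alpha>: "admissible_weights m \<alpha>" and m: "1 \<le> m"
    using mix by (auto simp: mixture_process_def admissible_points_def)
  interpret moment_sequence "{2..m}" "\<lambda>i. \<alpha> i / \<alpha> 1" x
    using x \<alpha> m by (rule moment_sequence_normalized)
  have "1 / (4 * 4 ^ n) \<le> (1 / 4 :: real)"
    by (simp add: field_simps)
  then have half: "1 / 2 \<le> \<alpha> 1"
    using large by linarith
  have "moment 0 = (1 - \<alpha> 1) / \<alpha> 1"
    using one_plus_moment_0[OF x \<alpha>] half by (simp add: field_simps)
  also have "\<dots> \<le> (1 - \<alpha> 1) / (1 / 2)"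
    using \<alpha> m half by (intro divide_left_mono) (auto simp: admissible_weights_def less_imp_le)
  also have "\<dots> \<le> 1 / (2 * 4 ^ n)"
    using large by (simp add: field_simps)
  finally have "2 * 4 ^ n * moment 0 \<le> 1"
    by (simp add: field_simps)
  moreover have "2 * 4 ^ a * moment 0 \<le> 2 * 4 ^ n * moment 0"
    using a moment_nonneg by (intro mult_right_mono mult_left_mono power_increasing) auto
  ultimately have "0 \<le> alt_diff a (\<lambda>k. ln (1 + moment k)) (n - a)"
    using a by (intro alt_diff_ln_moment_nonneg) auto
  then show "0 \<le> alt_diff a (\<lambda>k. ln (\<Sum>i=1..m. \<alpha> i * x i ^ k)) (n - a)"
    using alt_diff_ln_mixture[OF x \<alpha>] a by simp
qed

section \<open>First weight tending to zero\<close>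

text \<open>At \<open>t = 0\<close> the logarithms are linear in \<open>k\<close>, so the
  first-order term in \<open>t\<close> decides the sign. It is negative because
  \<open>1 - 1 / b < 0\<close> is raised to an odd power; 3 is the least odd order that is not
  automatic, whence \<open>n \<ge> 3\<close>.\<close>

lemma third_alt_diff_ln_two_points_negative:
  fixes b :: real
  assumes b: "0 < b" "b < 1"
  shows "\<exists>\<epsilon>>0. \<forall>t. 0 < t \<and> t < \<epsilon> \<longrightarrow> alt_diff 3 (\<lambda>k. ln (t + (1 - t) * b ^ k)) k < 0"
proof -
  define f where "f t = alt_diff 3 (\<lambda>k. ln (t + (1 - t) * b ^ k)) k" for t
  have "((\<lambda>t. ln (t + (1 - t) * b ^ j)) has_real_derivative ((1 / b) ^ j + - 1)) (at 0)" for j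
    using b by (auto intro!: derivative_eq_intros simp: field_simps)
  then have "(f has_real_derivative alt_diff 3 (\<lambda>j. (1 / b) ^ j + - 1) k) (at 0)"
    unfolding f_def by (rule alt_diff_has_real_derivative)
  moreover have "alt_diff 3 (\<lambda>j. (1 / b) ^ j + - 1) k = (1 / b) ^ k * (1 - 1 / b) ^ 3"
    by (simp only: alt_diff_add alt_diff_power) (simp add: alt_diff_const)
  moreover have "(1 / b) ^ k * (1 - 1 / b) ^ 3 < 0"
    using b by (intro mult_pos_neg) (auto simp: power_less_zero_eq)
  ultimately obtain d where d: "0 < d" "\<And>h. 0 < h \<Longrightarrow> h < d \<Longrightarrow> f (0 + h) < f 0"
    using DERIV_neg_dec_right[of f _ 0] by metis
  have "f 0 = alt_diff 3 (\<lambda>k. real k * ln b) k"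
    using b by (simp add: f_def ln_realpow)
  then have "f 0 = 0"
    by (simp only: alt_diff_linear)
  then show ?thesis
    using d by (auto simp: f_def)
qed

text \<open>At \<open>t = 0\<close> the first component is gone; dividing by \<open>c ^ k\<close>
  moves the second point to 1 and point \<open>i\<close> to \<open>c ^ (i - 2)\<close>, with equal
  weights. Then \<open>alt_diff_ln_moment_ge\<close> gives strict positivity, which persists for
  small \<open>t\<close> by continuity.\<close>

lemma exists_small_first_weight_representable:
  fixes m n :: nat
  assumes m: "3 \<le> m" and "0 < \<epsilon>"
    and c: "0 < c" "c < 1" "2 ^ n * c < 1 / real (m - 1)"
  defines "\<alpha> \<equiv> \<lambda>t i. if i = 1 then t else (1 - t) / real (m - 1)"
  obtains t where "0 < t" "t < 1" "t < \<epsilon>"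
    "\<And>a. a \<in> {2..n} \<Longrightarrow> 0 \<le> alt_diff a (\<lambda>k. ln (\<Sum>i=1..m. \<alpha> t i * (c ^ (i - 1)) ^ k)) (n - a)"
proof -
  interpret moment_sequence "{3..m}" "\<lambda>_. 1" "\<lambda>i. c ^ (i - 2)"
    using c by unfold_locales (auto simp: power_le_one)
  have L: "(\<Sum>i=1..m. \<alpha> t i * (c ^ (i - 1)) ^ k) = t + (1 - t) / real (m - 1) * (c ^ k * (1 + moment k))"
    for t k
  proof -
    have "{1..m} = insert 1 (insert 2 {3..m})"
      using m by auto
    moreover have "(\<Sum>i=3..m. \<alpha> t i * (c ^ (i - 1)) ^ k) = (1 - t) / real (m - 1) * (c ^ k * moment k)"
      unfolding moment_def sum_distrib_left
    proof (intro sum.cong refl)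
      fix i assume "i \<in> {3..m}"
      then have "i \<noteq> 1" "i - 1 = Suc (i - 2)"
        by auto
      then show "\<alpha> t i * (c ^ (i - 1)) ^ k = (1 - t) / real (m - 1) * (c ^ k * (1 * (c ^ (i - 2)) ^ k))"
        by (simp add: \<alpha>_def power_mult_distrib)
    qed
    ultimately show ?thesis
      by (simp add: \<alpha>_def algebra_simps)
  qed
  \<comment> \<open>Strictness needs a point besides the leading one, which is where
    \<open>m \<ge> 3\<close> enters; for \<open>m = 2\<close> the limiting differences of order at
    least 2 vanish.\<close>
  have moment_pos: "0 < moment k" for k
    unfolding moment_def using c m by (intro sum_pos) auto
  have "\<forall>\<^sub>F t in at_right 0. 0 < alt_diff a (\<lambda>k. ln (\<Sum>i=1..m. \<alpha> t i * (c ^ (i - 1)) ^ k)) (n - a)"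
    if a: "a \<in> {2..n}" for a
  proof -
    define \<phi> where "\<phi> k = ln (1 / real (m - 1) * (c ^ k * (1 + moment k)))" for k
    have pos: "0 < 1 / real (m - 1) * (c ^ k * (1 + moment k))" for k
      using c m moment_pos[of k] by simp
    have "((\<lambda>t. alt_diff a (\<lambda>k. ln (t + (1 - t) / real (m - 1) * (c ^ k * (1 + moment k)))) (n - a))
        \<longlongrightarrow> alt_diff a \<phi> (n - a)) (at_right 0)"
    proof (rule alt_diff_tendsto)
      fix k
      have "((\<lambda>t. t + (1 - t) / real (m - 1) * (c ^ k * (1 + moment k)))
          \<longlongrightarrow> 0 + (1 - 0) / real (m - 1) * (c ^ k * (1 + moment k))) (at_right 0)"
        by (intro tendsto_intros) (use m in auto)
      then have "((\<lambda>t. t + (1 - t) / real (m - 1) * (c ^ k * (1 + moment k)))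
          \<longlongrightarrow> 1 / real (m - 1) * (c ^ k * (1 + moment k))) (at_right 0)"
        by simp
      from tendsto_ln[OF this less_imp_neq[OF pos, symmetric]]
      show "((\<lambda>t. ln (t + (1 - t) / real (m - 1) * (c ^ k * (1 + moment k)))) \<longlongrightarrow> \<phi> k) (at_right 0)"
        unfolding \<phi>_def .
    qed
    moreover have "0 < alt_diff a \<phi> (n - a)"
    proof -
      have \<phi>: "\<phi> = (\<lambda>k. ln (1 / real (m - 1)) + (real k * ln c + ln (1 + moment k)))"
      proof
        fix k
        show "\<phi> k = ln (1 / real (m - 1)) + (real k * ln c + ln (1 + moment k))"
          unfolding \<phi>_def using c m moment_pos[of k]
          by (subst ln_mult_pos) (auto simp: ln_mult_pos ln_realpow add_pos_pos)
      qed
      have "alt_diff a \<phi> (n - a) = alt_diff a (\<lambda>k. ln (1 + moment k)) (n - a)"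
        unfolding \<phi> alt_diff_add using a by (simp add: alt_diff_const alt_diff_linear)
      moreover have "moment (n - a) * (1 / (1 + moment 0) - 2 ^ a * c)
          \<le> alt_diff a (\<lambda>k. ln (1 + moment k)) (n - a)"
      proof (rule alt_diff_ln_moment_ge)
        fix i assume "i \<in> {3..m}"
        then have "1 \<le> i - 2"
          by auto
        then show "c ^ (i - 2) \<le> c"
          using c power_decreasing[of 1 "i - 2" c] by simp
      qed (use c in simp)
      moreover have "2 ^ a * c < 1 / (1 + moment 0)"
      proof -
        have "2 ^ a * c \<le> 2 ^ n * c"
          using a c by (intro mult_right_mono power_increasing) auto
        also have "\<dots> < 1 / real (m - 1)"
          by (rule c)
        \<comment> \<open>There are \<open>m - 2\<close> points of weight 1 each, so the bound on
          \<open>c\<close> is the one that \<open>alt_diff_ln_moment_ge\<close> asks for.\<close>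
        also have "real (m - 1) = 1 + moment 0"
          using m by (simp add: moment_def of_nat_diff)
        finally show ?thesis .
      qed
      ultimately show ?thesis
        using mult_pos_pos[of "moment (n - a)" "1 / (1 + moment 0) - 2 ^ a * c"] moment_pos[of "n - a"]
        by linarith
    qed
    ultimately show ?thesis
      unfolding L by (rule order_tendstoD(1))
  qed
  \<comment> \<open>Only finitely many orders occur, so one right neighbourhood of 0 serves them
    all.\<close>
  then have "\<forall>\<^sub>F t in at_right 0. \<forall>a\<in>{2..n}.
      0 < alt_diff a (\<lambda>k. ln (\<Sum>i=1..m. \<alpha> t i * (c ^ (i - 1)) ^ k)) (n - a)"
    by (intro eventually_ball_finite) auto
  moreover have "\<forall>\<^sub>F t in at_right (0::real). t \<in> {0<..<min 1 \<epsilon>}"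
    using \<open>0 < \<epsilon>\<close> by (intro eventually_at_right_real) auto
  ultimately have "\<forall>\<^sub>F t in at_right 0. t \<in> {0<..<min 1 \<epsilon>} \<and> (\<forall>a\<in>{2..n}.
      0 < alt_diff a (\<lambda>k. ln (\<Sum>i=1..m. \<alpha> t i * (c ^ (i - 1)) ^ k)) (n - a))"
    by eventually_elim auto
  from eventually_happens[OF this] obtain t where "t \<in> {0<..<min 1 \<epsilon>}"
    "\<forall>a\<in>{2..n}. 0 < alt_diff a (\<lambda>k. ln (\<Sum>i=1..m. \<alpha> t i * (c ^ (i - 1)) ^ k)) (n - a)"
    by auto
  then show thesis
    by (intro that[of t]) (auto intro: less_imp_le)
qed

theorem proposition5p5:
  fixes n :: nat
  assumes "3 \<le> n"
  shows
    "(\<forall>a::real. 0 < a \<and> a < 1 \<longrightarrow>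
        (\<exists>\<delta>>0. \<forall>m x q \<alpha> (M :: 'w measure) X.
           2 \<le> m \<and> mixture_process m x q \<alpha> M X \<and> \<alpha> 1 = a \<and> x 2 < \<delta> \<longrightarrow>
           poisson_representable {1..n} M (restr X n)))
     \<and>
     (\<exists>\<epsilon>>0. \<forall>m x q \<alpha> (M :: 'w measure) X.
        2 \<le> m \<and> mixture_process m x q \<alpha> M X \<and> 1 - \<epsilon> < \<alpha> 1 \<longrightarrow>
        poisson_representable {1..n} M (restr X n))
     \<and>
     (\<forall>b::real. 0 < b \<and> b < 1 \<longrightarrow>
        (\<exists>\<epsilon>>0. \<forall>x q \<alpha> (M :: 'w measure) X.
           mixture_process 2 x q \<alpha> M X \<and> x 2 = b \<and> \<alpha> 1 < \<epsilon> \<longrightarrow>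
           \<not> poisson_representable {1..n} M (restr X n)))
     \<and>
     (\<forall>m\<ge>3. \<not> (\<forall>x. admissible_points m x \<and> 0 < x 2 \<longrightarrow>
        (\<exists>\<epsilon>>0. \<forall>q \<alpha> (M :: (nat \<Rightarrow> bool) measure) X.
           mixture_process m x q \<alpha> M X \<and> \<alpha> 1 < \<epsilon> \<longrightarrow>
           \<not> poisson_representable {1..n} M (restr X n))))"
proof (intro conjI)
  have n: "1 \<le> n"
    using assms by simp
  show "\<forall>a::real. 0 < a \<and> a < 1 \<longrightarrow>
      (\<exists>\<delta>>0. \<forall>m x q \<alpha> (M :: 'w measure) X.
         2 \<le> m \<and> mixture_process m x q \<alpha> M X \<and> \<alpha> 1 = a \<and> x 2 < \<delta> \<longrightarrow>
         poisson_representable {1..n} M (restr X n))"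
  proof (intro allI impI)
    fix a :: real assume a: "0 < a \<and> a < 1"
    have "poisson_representable {1..n} M (restr X n)"
      if "2 \<le> m \<and> mixture_process m x q \<alpha> M X \<and> \<alpha> 1 = a \<and> x 2 < a / 2 ^ n"
      for m x q \<alpha> and M :: "'w measure" and X
      using that by (intro representable_if_second_point_small[OF n]) auto
    then show "\<exists>\<delta>>0. \<forall>m x q \<alpha> (M :: 'w measure) X.
        2 \<le> m \<and> mixture_process m x q \<alpha> M X \<and> \<alpha> 1 = a \<and> x 2 < \<delta> \<longrightarrow>
        poisson_representable {1..n} M (restr X n)"
      using a by (intro exI[of _ "a / 2 ^ n"]) simp
  qed
  show "\<exists>\<epsilon>>0. \<forall>m x q \<alpha> (M :: 'w measure) X.
      2 \<le> m \<and> mixture_process m x q \<alpha> M X \<and> 1 - \<epsilon> < \<alpha> 1 \<longrightarrow>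
      poisson_representable {1..n} M (restr X n)"
    using representable_if_first_weight_large[OF n]
    by (intro exI[of _ "1 / (4 * 4 ^ n)"] conjI allI impI) (simp, blast)
  show "\<forall>b::real. 0 < b \<and> b < 1 \<longrightarrow>
      (\<exists>\<epsilon>>0. \<forall>x q \<alpha> (M :: 'w measure) X.
         mixture_process 2 x q \<alpha> M X \<and> x 2 = b \<and> \<alpha> 1 < \<epsilon> \<longrightarrow>
         \<not> poisson_representable {1..n} M (restr X n))"
  proof (intro allI impI)
    fix b :: real assume b: "0 < b \<and> b < 1"
    \<comment> \<open>The bound depends on \<open>b\<close> and \<open>n\<close> only, on the latter
      through the starting index \<open>n - 3\<close>.\<close>
    then obtain \<epsilon> where \<epsilon>: "0 < \<epsilon>"
      "\<And>t. 0 < t \<Longrightarrow> t < \<epsilon> \<Longrightarrow> alt_diff 3 (\<lambda>k. ln (t + (1 - t) * b ^ k)) (n - 3) < 0"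
      using third_alt_diff_ln_two_points_negative[of b "n - 3"] by blast
    have "\<not> poisson_representable {1..n} M (restr X n)"
      if mix: "mixture_process 2 x q \<alpha> M X" and "x 2 = b" "\<alpha> 1 < \<epsilon>" for x q \<alpha> and M :: "'w measure" and X
    proof -
      have "x 1 = 1" "\<alpha> 2 = 1 - \<alpha> 1" "0 < \<alpha> 1"
        using mix by (auto simp: mixture_process_def admissible_points_def admissible_weights_def numeral_2_eq_2)
      then have "(\<Sum>i=1..2. \<alpha> i * x i ^ k) = \<alpha> 1 + (1 - \<alpha> 1) * b ^ k" for k
        using \<open>x 2 = b\<close> by (simp add: numeral_2_eq_2)
      then have "alt_diff 3 (\<lambda>k. ln (\<Sum>i=1..2. \<alpha> i * x i ^ k)) (n - 3) < 0"
        using \<epsilon>(2)[OF \<open>0 < \<alpha> 1\<close> \<open>\<alpha> 1 < \<epsilon>\<close>] by simp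
      then show ?thesis
        unfolding mixture_representable_iff[OF mix n] using assms by (auto simp: not_le intro!: bexI[of _ 3])
    qed
    then show "\<exists>\<epsilon>>0. \<forall>x q \<alpha> (M :: 'w measure) X.
        mixture_process 2 x q \<alpha> M X \<and> x 2 = b \<and> \<alpha> 1 < \<epsilon> \<longrightarrow>
        \<not> poisson_representable {1..n} M (restr X n)"
      using \<epsilon>(1) by blast
  qed
  show "\<forall>m\<ge>3. \<not> (\<forall>x. admissible_points m x \<and> 0 < x 2 \<longrightarrow>
      (\<exists>\<epsilon>>0. \<forall>q \<alpha> (M :: (nat \<Rightarrow> bool) measure) X.
         mixture_process m x q \<alpha> M X \<and> \<alpha> 1 < \<epsilon> \<longrightarrow>
         \<not> poisson_representable {1..n} M (restr X n)))"
  proof (intro allI impI notI)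
    fix m :: nat
    assume m: "3 \<le> m" and *: "\<forall>x. admissible_points m x \<and> 0 < x 2 \<longrightarrow>
      (\<exists>\<epsilon>>0. \<forall>q \<alpha> (M :: (nat \<Rightarrow> bool) measure) X.
         mixture_process m x q \<alpha> M X \<and> \<alpha> 1 < \<epsilon> \<longrightarrow>
         \<not> poisson_representable {1..n} M (restr X n))"
    \<comment> \<open>This gives \<open>2 ^ n * c = 1 / m\<close>, just below the required
      \<open>1 / (m - 1)\<close>.\<close>
    define c where "c = 1 / (2 ^ n * real m)"
    define x where "x i = c ^ (i - 1)" for i :: nat
    have c: "0 < c" "c < 1" "2 ^ n * c < 1 / real (m - 1)"
    proof -
      have "1 < 2 ^ n * real m"
        using m mult_mono[of 1 "2 ^ n" 3 "real m"] by simp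
      then show "0 < c" "c < 1"
        by (auto simp: c_def)
      show "2 ^ n * c < 1 / real (m - 1)"
        using m by (simp add: c_def divide_strict_left_mono)
    qed
    have x: "admissible_points m x" "0 < x 2"
      using c m by (auto simp: admissible_points_def x_def intro: power_strict_decreasing)
    from *[THEN spec, THEN mp, OF conjI[OF x]] obtain \<epsilon> where \<epsilon>: "0 < \<epsilon>"
      "\<forall>q \<alpha> (M :: (nat \<Rightarrow> bool) measure) X. mixture_process m x q \<alpha> M X \<and> \<alpha> 1 < \<epsilon> \<longrightarrow>
         \<not> poisson_representable {1..n} M (restr X n)"
      by (elim exE conjE)
    define \<alpha> where "\<alpha> t i = (if i = 1 then t else (1 - t) / real (m - 1))" for t and i :: nat
    obtain t where t: "0 < t" "t < 1" "t < \<epsilon>"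
      "\<And>a. a \<in> {2..n} \<Longrightarrow> 0 \<le> alt_diff a (\<lambda>k. ln (\<Sum>i=1..m. \<alpha> t i * x i ^ k)) (n - a)"
      by (rule exists_small_first_weight_representable[OF m \<epsilon>(1) c], rule that)
        (simp_all only: \<alpha>_def x_def)
    have \<alpha>: "admissible_weights m (\<alpha> t)"
    proof -
      have "{1..m} = insert 1 {2..m}"
        using m by auto
      moreover have "(\<Sum>i=2..m. \<alpha> t i) = (\<Sum>i=2..m. (1 - t) / real (m - 1))"
        by (intro sum.cong) (auto simp: \<alpha>_def)
      moreover have "(1 - t) / real (m - 1) < 1"
        using t m by (simp add: field_simps of_nat_diff)
      ultimately show ?thesis
        using t m by (auto simp: admissible_weights_def \<alpha>_def)
    qed
    \<comment> \<open>The counterexample is the coordinate process on sequence space under the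
      mixture law itself, with \<open>q = 1\<close>.\<close>
    define M where "M = bernoulli_mixture m x 1 (\<alpha> t)"
    have "prob_space M" "sets M = sets (binary_space {1..})"
      unfolding M_def using prob_space_bernoulli_mixture sets_bernoulli_mixture x \<alpha> by auto
    then have "has_law M (\<lambda>\<omega>. \<omega>) M"
      using measurable_ident_sets[of M "binary_space {1..}"] distr_id2[of "binary_space {1..}" M]
      by (auto simp: has_law_def id_def)
    then have mix: "mixture_process m x 1 (\<alpha> t) M (\<lambda>\<omega>. \<omega>)"
      using x \<alpha> by (simp add: mixture_process_def M_def)
    then have "poisson_representable {1..n} M (restr (\<lambda>\<omega>. \<omega>) n)"
      unfolding mixture_representable_iff[OF mix n] using t(4) by blast
    moreover have "\<alpha> t 1 < \<epsilon>"
      using t by (simp add: \<alpha>_def)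
    ultimately show False
      using \<epsilon>(2) mix by blast
  qed
qed

end
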